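(* An inductive rule class $\mathbf{K}$ of Gödel algebras is inductively complete if and only if it is minimal (with respect to inclusion) among non-empty inductive rule classes of Gödel algebras.
   Context: Gödel algebras are Heyting algebras satisfying $(x\to y)\vee(y\to x)=1$ (algebras of $\mathsf{LC}=\mathsf{IPC}+(p\to q)\vee(q\to p)$). A $\forall$-subalgebra of $\mathcal{B}$ is a subalgebra $\mathcal{A}$ such that for every equation $\phi(\overline x,\overline y)$ and tuple $\overline a$ in $A$, $\mathcal{A}\vDash\forall\overline x\phi(\overline x,\overline a)$ implies $\mathcal{B}\vDash\forall\overline x\phi(\overline x,\overline a)$. An inductive rule class is a class closed under isomorphic copies of $\forall$-subalgebras, direct products and ultraproducts. A $\Pi_2$-rule $\Gamma/^2\psi$ (finite premises $\Gamma$ in $\overline p,\overline q$, conclusion $\psi$ in $\overline p$, bound variables $\overline q$) is valid in an algebra iff it satisfies $\forall\overline y(\forall\overline x(\bigwedge\Gamma(\overline x,\overline y)\approx1)\to\psi(\overline y)\approx1)$. $\Pi_2(\mathbf{K})$ is the set of $\Pi_2$-rules valid in all members of $\mathbf{K}$; it is a $\Pi_2$-rule system (a set of $\Pi_2$-rules closed under Strong Reflexivity, Monotonicity, $\alpha$-renaming, Rule cut and Bound Structurality). A rule $R$ is admissible in $\mathbf{K}$ if for every formula $\chi$, $\emptyset/^2\chi\in\Pi_2(\mathbf{K})\oplus R$ implies $\emptyset/^2\chi\in\Pi_2(\mathbf{K})$, where $\Pi_2(\mathbf{K})\oplus R$ is the smallest $\Pi_2$-rule system containing $\Pi_2(\mathbf{K})\cup\{R\}$.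 $\mathbf{K}$ is inductively complete if every $\Pi_2$-rule admissible in $\mathbf{K}$ belongs to $\Pi_2(\mathbf{K})$.
   Formalization: Algebras are nondegenerate (0≠1), products are over non-empty families and K is non-empty, since with one-element algebras or the empty class the equivalence fails; a class is represented by its members on an arbitrary fixed infinite carrier set. *)

theory Defs
  imports Main "HOL-Library.FuncSet"
begin

section \<open>Heyting algebras and Goedel algebras\<close>

record 'a heyting =
  carr :: "'a set"
  meet :: "'a \<Rightarrow> 'a \<Rightarrow> 'a"
  join :: "'a \<Rightarrow> 'a \<Rightarrow> 'a"
  impl :: "'a \<Rightarrow> 'a \<Rightarrow> 'a"
  zero :: 'a
  one :: 'a

definition le :: "'a heyting \<Rightarrow> 'a \<Rightarrow> 'a \<Rightarrow> bool" where
  "le A x y \<longleftrightarrow> meet A x y = x"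

definition heyting_algebra :: "'a heyting \<Rightarrow> bool" where
  "heyting_algebra A \<longleftrightarrow>
     zero A \<in> carr A \<and> one A \<in> carr A \<and>
     (\<forall>x\<in>carr A. \<forall>y\<in>carr A.
        meet A x y \<in> carr A \<and> join A x y \<in> carr A \<and> impl A x y \<in> carr A) \<and>
     (\<forall>x\<in>carr A. \<forall>y\<in>carr A. meet A x y = meet A y x \<and> join A x y = join A y x) \<and>
     (\<forall>x\<in>carr A. \<forall>y\<in>carr A. \<forall>z\<in>carr A.
        meet A (meet A x y) z = meet A x (meet A y z) \<and>
        join A (join A x y) z = join A x (join A y z)) \<and>
     (\<forall>x\<in>carr A. \<forall>y\<in>carr A. meet A x (join A x y) = x \<and> join A x (meet A x y) = x) \<and>
     (\<forall>x\<in>carr A. le A (zero A) x \<and> le A x (one A)) \<and>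
     (\<forall>x\<in>carr A. \<forall>y\<in>carr A. \<forall>z\<in>carr A. le A (meet A x y) z \<longleftrightarrow> le A x (impl A y z))"

definition godel_algebra :: "'a heyting \<Rightarrow> bool" where
  "godel_algebra A \<longleftrightarrow> heyting_algebra A \<and>
     (\<forall>x\<in>carr A. \<forall>y\<in>carr A. join A (impl A x y) (impl A y x) = one A)"

definition nondegenerate :: "'a heyting \<Rightarrow> bool" where
  "nondegenerate A \<longleftrightarrow> zero A \<noteq> one A"


section \<open>Formulas, equations and their evaluation\<close>

datatype fm = Var nat | Bot | Top | And fm fm | Or fm fm | Imp fm fm

primrec vars :: "fm \<Rightarrow> nat set" where
  "vars (Var i) = {i}"
| "vars Bot = {}"
| "vars Top = {}"
| "vars (And \<phi> \<psi>) = vars \<phi> \<union> vars \<psi>"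
| "vars (Or \<phi> \<psi>) = vars \<phi> \<union> vars \<psi>"
| "vars (Imp \<phi> \<psi>) = vars \<phi> \<union> vars \<psi>"

primrec subst :: "(nat \<Rightarrow> fm) \<Rightarrow> fm \<Rightarrow> fm" where
  "subst \<sigma> (Var i) = \<sigma> i"
| "subst \<sigma> Bot = Bot"
| "subst \<sigma> Top = Top"
| "subst \<sigma> (And \<phi> \<psi>) = And (subst \<sigma> \<phi>) (subst \<sigma> \<psi>)"
| "subst \<sigma> (Or \<phi> \<psi>) = Or (subst \<sigma> \<phi>) (subst \<sigma> \<psi>)"
| "subst \<sigma> (Imp \<phi> \<psi>) = Imp (subst \<sigma> \<phi>) (subst \<sigma> \<psi>)"

primrec eval :: "'a heyting \<Rightarrow> (nat \<Rightarrow> 'a) \<Rightarrow> fm \<Rightarrow> 'a" where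
  "eval A v (Var i) = v i"
| "eval A v Bot = zero A"
| "eval A v Top = one A"
| "eval A v (And \<phi> \<psi>) = meet A (eval A v \<phi>) (eval A v \<psi>)"
| "eval A v (Or \<phi> \<psi>) = join A (eval A v \<phi>) (eval A v \<psi>)"
| "eval A v (Imp \<phi> \<psi>) = impl A (eval A v \<phi>) (eval A v \<psi>)"

definition valuations :: "'a heyting \<Rightarrow> (nat \<Rightarrow> 'a) set" where
  "valuations A = {v. \<forall>i. v i \<in> carr A}"

text \<open>The valuations obtained from \<open>v\<close> by reassigning the variables in \<open>X\<close>; quantifying over
  them interprets a universal quantifier over the tuple of variables \<open>X\<close>.\<close>

definition variants :: "'a heyting \<Rightarrow> nat set \<Rightarrow> (nat \<Rightarrow> 'a) \<Rightarrow> (nat \<Rightarrow> 'a) set" where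
  "variants A X v = {w \<in> valuations A. \<forall>i. i \<notin> X \<longrightarrow> w i = v i}"

definition sat_all_eq :: "'a heyting \<Rightarrow> nat set \<Rightarrow> (nat \<Rightarrow> 'a) \<Rightarrow> fm \<Rightarrow> fm \<Rightarrow> bool" where
  "sat_all_eq A X v s t \<longleftrightarrow> (\<forall>w\<in>variants A X v. eval A w s = eval A w t)"



section \<open>Constructions on algebras\<close>

definition subalgebra :: "'a heyting \<Rightarrow> 'a heyting \<Rightarrow> bool" where
  "subalgebra A B \<longleftrightarrow> heyting_algebra A \<and> heyting_algebra B \<and> carr A \<subseteq> carr B \<and>
     zero A = zero B \<and> one A = one B \<and>
     (\<forall>x\<in>carr A. \<forall>y\<in>carr A.
        meet A x y = meet B x y \<and> join A x y = join B x y \<and> impl A x y = impl B x y)"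

definition forall_subalgebra :: "'a heyting \<Rightarrow> 'a heyting \<Rightarrow> bool" where
  "forall_subalgebra A B \<longleftrightarrow> subalgebra A B \<and>
     (\<forall>s t X. \<forall>v\<in>valuations A. finite X \<longrightarrow> sat_all_eq A X v s t \<longrightarrow> sat_all_eq B X v s t)"

definition isomorphic :: "'a heyting \<Rightarrow> 'b heyting \<Rightarrow> bool" where
  "isomorphic A B \<longleftrightarrow> (\<exists>h. bij_betw h (carr A) (carr B) \<and>
     h (zero A) = zero B \<and> h (one A) = one B \<and>
     (\<forall>x\<in>carr A. \<forall>y\<in>carr A.
        h (meet A x y) = meet B (h x) (h y) \<and>
        h (join A x y) = join B (h x) (h y) \<and>
        h (impl A x y) = impl B (h x) (h y)))"

definition copy_of_forall_subalgebra :: "'a heyting \<Rightarrow> 'b heyting \<Rightarrow> bool" where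
  "copy_of_forall_subalgebra A B \<longleftrightarrow>
     heyting_algebra A \<and> (\<exists>C. forall_subalgebra C B \<and> isomorphic A C)"

definition direct_product :: "'i set \<Rightarrow> ('i \<Rightarrow> 'a heyting) \<Rightarrow> ('i \<Rightarrow> 'a) heyting" where
  "direct_product I A =
    \<lparr> carr = (\<Pi>\<^sub>E i\<in>I. carr (A i)),
      meet = (\<lambda>f g. \<lambda>i\<in>I. meet (A i) (f i) (g i)),
      join = (\<lambda>f g. \<lambda>i\<in>I. join (A i) (f i) (g i)),
      impl = (\<lambda>f g. \<lambda>i\<in>I. impl (A i) (f i) (g i)),
      zero = (\<lambda>i\<in>I. zero (A i)),
      one = (\<lambda>i\<in>I. one (A i)) \<rparr>"

definition ultrafilter_on :: "'i set \<Rightarrow> 'i set set \<Rightarrow> bool" where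
  "ultrafilter_on I U \<longleftrightarrow> U \<subseteq> Pow I \<and> I \<in> U \<and> {} \<notin> U \<and>
     (\<forall>X\<in>U. \<forall>Y\<in>U. X \<inter> Y \<in> U) \<and>
     (\<forall>X\<in>U. \<forall>Y. X \<subseteq> Y \<and> Y \<subseteq> I \<longrightarrow> Y \<in> U) \<and>
     (\<forall>X. X \<subseteq> I \<longrightarrow> X \<in> U \<or> I - X \<in> U)"

definition ultra_rel ::
    "'i set \<Rightarrow> 'i set set \<Rightarrow> ('i \<Rightarrow> 'a heyting) \<Rightarrow> (('i \<Rightarrow> 'a) \<times> ('i \<Rightarrow> 'a)) set" where
  "ultra_rel I U A =
     {(f, g). f \<in> carr (direct_product I A) \<and> g \<in> carr (direct_product I A) \<and>
              {i \<in> I. f i = g i} \<in> U}"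

definition ultraproduct ::
    "'i set \<Rightarrow> 'i set set \<Rightarrow> ('i \<Rightarrow> 'a heyting) \<Rightarrow> ('i \<Rightarrow> 'a) set heyting" where
  "ultraproduct I U A = (let P = direct_product I A; r = ultra_rel I U A in
    \<lparr> carr = carr P // r,
      meet = (\<lambda>F G. r `` {meet P f g | f g. f \<in> F \<and> g \<in> G}),
      join = (\<lambda>F G. r `` {join P f g | f g. f \<in> F \<and> g \<in> G}),
      impl = (\<lambda>F G. r `` {impl P f g | f g. f \<in> F \<and> g \<in> G}),
      zero = r `` {zero P},
      one = r `` {one P} \<rparr>)"


section \<open>Inductive rule classes\<close>

text \<open>
  A class is represented by the set of its members whose carrier is contained in a fixed infinite
  type \<^typ>\<open>'a\<close>; index sets of products and ultraproducts range over the subsets of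
  a type \<^typ>\<open>'i\<close> at least as large as \<^typ>\<open>'a\<close>. A product or
  ultraproduct need not fit into \<^typ>\<open>'a\<close>, so closure under products and
  ultraproducts is expressed through the isomorphic copies of their \<open>\<forall>\<close>-subalgebras (among them
  the products and ultraproducts themselves). By the downward Loewenheim-Skolem theorem these
  members determine the class.

  Algebras are nondegenerate, and accordingly products are over non-empty families: the one-element
  algebra validates every rule, so the class of one-element algebras would otherwise be the only
  minimal non-empty class, although other classes are inductively complete.
\<close>

definition inductive_rule_class :: "'i itself \<Rightarrow> 'a heyting set \<Rightarrow> bool" where
  "inductive_rule_class _ K \<longleftrightarrow>
     (\<forall>A\<in>K. godel_algebra A \<and> nondegenerate A) \<and>
     (\<forall>A\<in>K. \<forall>B. copy_of_forall_subalgebra B A \<longrightarrow> B \<in> K) \<and>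
     (\<forall>(I :: 'i set) A B. I \<noteq> {} \<longrightarrow> (\<forall>i\<in>I. A i \<in> K) \<longrightarrow>
        copy_of_forall_subalgebra B (direct_product I A) \<longrightarrow> B \<in> K) \<and>
     (\<forall>(I :: 'i set) U A B. ultrafilter_on I U \<longrightarrow> (\<forall>i\<in>I. A i \<in> K) \<longrightarrow>
        copy_of_forall_subalgebra B (ultraproduct I U A) \<longrightarrow> B \<in> K)"


section \<open>\<open>\<Pi>\<^sub>2\<close>-rules\<close>

text \<open>The triple \<open>(\<Gamma>, Q, \<psi>)\<close> stands for the rule with premises \<open>\<Gamma>\<close>, bound variables \<open>Q\<close> and
  conclusion \<open>\<psi>\<close>.\<close>

type_synonym pi2_rule = "fm set \<times> nat set \<times> fm"

definition pi2_rules :: "pi2_rule set" where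
  "pi2_rules = {(\<Gamma>, Q, \<psi>). finite \<Gamma> \<and> finite Q \<and> vars \<psi> \<inter> Q = {}}"

definition valid :: "'a heyting \<Rightarrow> pi2_rule \<Rightarrow> bool" where
  "valid A = (\<lambda>(\<Gamma>, Q, \<psi>). \<forall>v\<in>valuations A.
     (\<forall>w\<in>variants A Q v. \<forall>\<gamma>\<in>\<Gamma>. eval A w \<gamma> = one A) \<longrightarrow> eval A v \<psi> = one A)"

definition Pi2 :: "'a heyting set \<Rightarrow> pi2_rule set" where
  "Pi2 K = {R \<in> pi2_rules. \<forall>A\<in>K. valid A R}"

text \<open>Strong reflexivity: a premise yields each of its instances obtained by substituting formulas
  without bound variables for the bound variables.\<close>

definition strong_reflexivity :: "pi2_rule set \<Rightarrow> bool" where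
  "strong_reflexivity S \<longleftrightarrow>
     (\<forall>\<Gamma> Q \<phi> \<sigma>. \<phi> \<in> \<Gamma> \<longrightarrow> (\<forall>i. i \<notin> Q \<longrightarrow> \<sigma> i = Var i) \<longrightarrow>
        (\<Gamma>, Q, subst \<sigma> \<phi>) \<in> pi2_rules \<longrightarrow> (\<Gamma>, Q, subst \<sigma> \<phi>) \<in> S)"

definition monotonicity :: "pi2_rule set \<Rightarrow> bool" where
  "monotonicity S \<longleftrightarrow>
     (\<forall>\<Gamma> Q \<psi> \<Gamma>' Q'. (\<Gamma>, Q, \<psi>) \<in> S \<longrightarrow> \<Gamma> \<subseteq> \<Gamma>' \<longrightarrow> Q \<subseteq> Q' \<longrightarrow>
        (\<Gamma>', Q', \<psi>) \<in> pi2_rules \<longrightarrow> (\<Gamma>', Q', \<psi>) \<in> S)"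

definition alpha_renaming :: "pi2_rule set \<Rightarrow> bool" where
  "alpha_renaming S \<longleftrightarrow>
     (\<forall>\<Gamma> Q \<psi> f. (\<Gamma>, Q, \<psi>) \<in> S \<longrightarrow> inj_on f Q \<longrightarrow>
        f ` Q \<inter> ((\<Union>\<gamma>\<in>\<Gamma>. vars \<gamma>) - Q) = {} \<longrightarrow> f ` Q \<inter> vars \<psi> = {} \<longrightarrow>
        (subst (\<lambda>i. Var (if i \<in> Q then f i else i)) ` \<Gamma>, f ` Q, \<psi>) \<in> S)"

text \<open>Rule cut: if the bound variables \<open>Q'\<close> of a rule with premises \<open>\<Delta>\<close> are not free in \<open>\<Gamma>\<close>, then
  deriving every member of \<open>\<Delta>\<close> from \<open>\<Gamma>\<close> amounts to deriving it for all values of \<open>Q'\<close>.\<close>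

definition rule_cut :: "pi2_rule set \<Rightarrow> bool" where
  "rule_cut S \<longleftrightarrow>
     (\<forall>\<Gamma> Q \<Delta> Q' \<psi>. (\<forall>\<delta>\<in>\<Delta>. (\<Gamma>, Q, \<delta>) \<in> S) \<longrightarrow> (\<Delta>, Q', \<psi>) \<in> S \<longrightarrow>
        Q' \<inter> ((\<Union>\<gamma>\<in>\<Gamma>. vars \<gamma>) - Q) = {} \<longrightarrow>
        (\<Gamma>, Q, \<psi>) \<in> pi2_rules \<longrightarrow> (\<Gamma>, Q, \<psi>) \<in> S)"

text \<open>Bound structurality: closure under substitutions that fix the bound variables and do not
  capture any variable.\<close>

definition bound_structurality :: "pi2_rule set \<Rightarrow> bool" where
  "bound_structurality S \<longleftrightarrow>
     (\<forall>\<Gamma> Q \<psi> \<sigma>. (\<Gamma>, Q, \<psi>) \<in> S \<longrightarrow> (\<forall>i\<in>Q. \<sigma> i = Var i) \<longrightarrow>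
        (\<forall>i. i \<notin> Q \<longrightarrow> vars (\<sigma> i) \<inter> Q = {}) \<longrightarrow>
        (subst \<sigma> ` \<Gamma>, Q, subst \<sigma> \<psi>) \<in> S)"

definition pi2_rule_system :: "pi2_rule set \<Rightarrow> bool" where
  "pi2_rule_system S \<longleftrightarrow> S \<subseteq> pi2_rules \<and> strong_reflexivity S \<and> monotonicity S \<and>
     alpha_renaming S \<and> rule_cut S \<and> bound_structurality S"

definition oplus :: "pi2_rule set \<Rightarrow> pi2_rule \<Rightarrow> pi2_rule set" where
  "oplus S R = \<Inter>{S'. pi2_rule_system S' \<and> S \<union> {R} \<subseteq> S'}"

definition admissible :: "'a heyting set \<Rightarrow> pi2_rule \<Rightarrow> bool" where
  "admissible K R \<longleftrightarrow> (\<forall>\<chi>. ({}, {}, \<chi>) \<in> oplus (Pi2 K) R \<longrightarrow> ({}, {}, \<chi>) \<in> Pi2 K)"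

definition inductively_complete :: "'a heyting set \<Rightarrow> bool" where
  "inductively_complete K \<longleftrightarrow> (\<forall>R\<in>pi2_rules. admissible K R \<longrightarrow> R \<in> Pi2 K)"

end

theory Submission
  imports Defs "HOL-Library.Countable"
begin

text \<open>
  An inductive rule class contains every nondegenerate algebra that validates its \<open>\<Pi>\<^sub>2\<close>-rules:
  failure of a rule in such an algebra yields a model in the class of each finite part of its
  diagram (finite products refute several formulas at once), and an ultraproduct of these models
  has the algebra as a \<open>\<forall>\<close>-subalgebra.

  If \<^term>\<open>K\<close> is minimal and the rule \<open>R\<close> is admissible, the members of \<^term>\<open>K\<close> that
  validate \<open>R\<close> form an inductive rule class. It is non-empty because it contains the free algebra on
  countably many generators of \<open>\<Pi>\<^sub>2(K) \<oplus> R\<close>, which is nondegenerate by admissibility.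

  If \<^term>\<open>K\<close> is inductively complete, all members of \<^term>\<open>K\<close> satisfy the same equations,
  so every rule valid in a non-empty inductive subclass is admissible in \<^term>\<open>K\<close>, hence valid in
  \<^term>\<open>K\<close>, and the subclass is all of \<^term>\<open>K\<close>.
\<close>

section \<open>Evaluation in Heyting algebras\<close>

text \<open>The members of a class live on the fixed type \<open>'a\<close>, and this shapes several
  constructions. Binary products are copied into \<open>'a\<close> by a pairing function. The free
  algebra fits because there are only countably many formulas. The ultraproduct over the finite
  parts of a diagram never has to fit: only the \<forall>-subalgebra isomorphic to the given algebra
  must lie on \<open>'a\<close>. Its indices are pairs of a parameter list and a number, which an
  infinite \<open>'a\<close> can encode and which \<open>e\<close> carries on to \<open>'i\<close>.
  The other obstacle is that a rule has a single conclusion, whereas a diagram contains many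
  inequations. Each inequation therefore gives a rule of its own with its own countermodel, and it
  is these countermodels that the finite products combine.\<close>

lemma heyting_closed [simp]:
  assumes "heyting_algebra A"
  shows "zero A \<in> carr A" "one A \<in> carr A"
    "x \<in> carr A \<Longrightarrow> y \<in> carr A \<Longrightarrow> meet A x y \<in> carr A"
    "x \<in> carr A \<Longrightarrow> y \<in> carr A \<Longrightarrow> join A x y \<in> carr A"
    "x \<in> carr A \<Longrightarrow> y \<in> carr A \<Longrightarrow> impl A x y \<in> carr A"
  using assms unfolding heyting_algebra_def by auto

lemma heyting_comm:
  assumes "heyting_algebra A" "x \<in> carr A" "y \<in> carr A"
  shows "meet A x y = meet A y x" "join A x y = join A y x"
  using assms unfolding heyting_algebra_def by auto

lemma heyting_assoc:
  assumes "heyting_algebra A" "x \<in> carr A" "y \<in> carr A" "z \<in> carr A"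
  shows "meet A (meet A x y) z = meet A x (meet A y z)"
    "join A (join A x y) z = join A x (join A y z)"
  using assms unfolding heyting_algebra_def by auto

lemma heyting_absorb:
  assumes "heyting_algebra A" "x \<in> carr A" "y \<in> carr A"
  shows "meet A x (join A x y) = x" "join A x (meet A x y) = x"
  using assms unfolding heyting_algebra_def by auto

lemma heyting_bounds:
  assumes "heyting_algebra A" "x \<in> carr A"
  shows "meet A (zero A) x = zero A" "meet A x (one A) = x"
  using assms unfolding heyting_algebra_def le_def by auto

lemma heyting_residuation:
  assumes "heyting_algebra A" "x \<in> carr A" "y \<in> carr A" "z \<in> carr A"
  shows "meet A (meet A x y) z = meet A x y \<longleftrightarrow> meet A x (impl A y z) = x"
  using assms unfolding heyting_algebra_def le_def by auto

lemma heyting_meet_eq_one_iff: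
  assumes "heyting_algebra A" "x \<in> carr A" "y \<in> carr A"
  shows "meet A x y = one A \<longleftrightarrow> x = one A \<and> y = one A"
proof -
  have idem: "meet A z z = z" if "z \<in> carr A" for z
    using assms(1) that unfolding heyting_algebra_def by metis
  have "meet A x (meet A x y) = meet A x y" "meet A y (meet A x y) = meet A x y"
    using assms idem unfolding heyting_algebra_def by metis+
  moreover have "meet A x (one A) = x" "meet A y (one A) = y"
    using assms unfolding heyting_algebra_def le_def by auto
  ultimately show ?thesis
    using idem assms by (metis heyting_closed(2))
qed

lemma heyting_impl_eq_one_iff:
  assumes "heyting_algebra A" "x \<in> carr A" "y \<in> carr A"
  shows "impl A x y = one A \<longleftrightarrow> le A x y"
proof -
  have top: "meet A (one A) z = z" if "z \<in> carr A" for z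
    using assms(1) that unfolding heyting_algebra_def le_def by metis
  have "le A (meet A (one A) x) y \<longleftrightarrow> le A (one A) (impl A x y)"
    using assms unfolding heyting_algebra_def by blast
  then show ?thesis
    using top assms unfolding le_def by (metis heyting_closed(5))
qed

lemma heyting_iff_eq_one:
  assumes "heyting_algebra A" "x \<in> carr A" "y \<in> carr A"
  shows "meet A (impl A x y) (impl A y x) = one A \<longleftrightarrow> x = y"
proof -
  have "meet A x y = meet A y x" "meet A x x = x"
    using assms unfolding heyting_algebra_def by metis+
  then show ?thesis
    using assms by (auto simp: heyting_meet_eq_one_iff heyting_impl_eq_one_iff le_def)
qed

text \<open>Rules speak of formulas with value \<open>one\<close>, \<forall>-subalgebras speak of
  equations. This formula translates the second language into the first.\<close>

definition Iff :: "fm \<Rightarrow> fm \<Rightarrow> fm" where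
  "Iff \<phi> \<psi> = And (Imp \<phi> \<psi>) (Imp \<psi> \<phi>)"

lemma finite_vars [simp]: "finite (vars \<phi>)"
  by (induction \<phi>) auto

lemma vars_subst: "vars (subst \<sigma> \<phi>) = (\<Union>i\<in>vars \<phi>. vars (\<sigma> i))"
  by (induction \<phi>) auto

lemma eval_cong: "(\<And>i. i \<in> vars \<phi> \<Longrightarrow> v i = w i) \<Longrightarrow> eval A v \<phi> = eval A w \<phi>"
  by (induction \<phi>) auto

lemma subst_cong: "(\<And>i. i \<in> vars \<phi> \<Longrightarrow> \<sigma> i = \<tau> i) \<Longrightarrow> subst \<sigma> \<phi> = subst \<tau> \<phi>"
  by (induction \<phi>) auto

lemma eval_subst: "eval A v (subst \<sigma> \<phi>) = eval A (\<lambda>i. eval A v (\<sigma> i)) \<phi>"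
  by (induction \<phi>) auto

lemma subst_subst: "subst \<sigma> (subst \<tau> \<phi>) = subst (\<lambda>i. subst \<sigma> (\<tau> i)) \<phi>"
  by (induction \<phi>) auto

lemma eval_in_carr [simp]:
  "heyting_algebra A \<Longrightarrow> v \<in> valuations A \<Longrightarrow> eval A v \<phi> \<in> carr A"
  by (induction \<phi>) (auto simp: valuations_def)

lemma eval_Iff_eq_one:
  "heyting_algebra A \<Longrightarrow> v \<in> valuations A \<Longrightarrow>
    eval A v (Iff \<phi> \<psi>) = one A \<longleftrightarrow> eval A v \<phi> = eval A v \<psi>"
  by (simp add: Iff_def heyting_iff_eq_one)

lemma variants_valuations: "w \<in> variants A X v \<Longrightarrow> w \<in> valuations A"
  by (simp add: variants_def)

lemma variants_empty: "v \<in> valuations A \<Longrightarrow> variants A {} v = {v}"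
  by (auto simp: variants_def fun_eq_iff)

section \<open>Homomorphisms and transport of structure\<close>

definition heyting_hom :: "('a \<Rightarrow> 'b) \<Rightarrow> 'a heyting \<Rightarrow> 'b heyting \<Rightarrow> bool" where
  "heyting_hom h A B \<longleftrightarrow> h ` carr A \<subseteq> carr B \<and> h (zero A) = zero B \<and> h (one A) = one B \<and>
     (\<forall>x\<in>carr A. \<forall>y\<in>carr A.
        h (meet A x y) = meet B (h x) (h y) \<and>
        h (join A x y) = join B (h x) (h y) \<and>
        h (impl A x y) = impl B (h x) (h y))"

lemma eval_hom:
  assumes "heyting_algebra A" "heyting_hom h A B" "v \<in> valuations A"
  shows "eval B (\<lambda>i. h (v i)) \<phi> = h (eval A v \<phi>)"
  by (induction \<phi>) (use assms in \<open>auto simp: heyting_hom_def\<close>)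

lemma isomorphic_iff:
  "isomorphic A B \<longleftrightarrow> (\<exists>h. bij_betw h (carr A) (carr B) \<and> heyting_hom h A B)"
  unfolding isomorphic_def heyting_hom_def bij_betw_def by (intro ex_cong1) auto

text \<open>Identities pull back along a jointly injective family of homomorphisms. Residuation is
  an equivalence of two equations; it pulls back because these are equivalent in every
  \<open>A i\<close>, hence so are their conjunctions over \<open>i\<close>. The argument serves
  products (projections), copies (an isomorphism) and subalgebras (the inclusion).\<close>

lemma heyting_algebra_of_homs:
  assumes A: "\<And>i. i \<in> I \<Longrightarrow> heyting_algebra (A i)"
    and h: "\<And>i. i \<in> I \<Longrightarrow> heyting_hom (h i) B (A i)"
    and sep: "\<And>x y. x \<in> carr B \<Longrightarrow> y \<in> carr B \<Longrightarrow> (\<And>i. i \<in> I \<Longrightarrow> h i x = h i y) \<Longrightarrow> x = y"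
    and cl: "zero B \<in> carr B" "one B \<in> carr B"
      "\<And>x y. x \<in> carr B \<Longrightarrow> y \<in> carr B \<Longrightarrow> meet B x y \<in> carr B"
      "\<And>x y. x \<in> carr B \<Longrightarrow> y \<in> carr B \<Longrightarrow> join B x y \<in> carr B"
      "\<And>x y. x \<in> carr B \<Longrightarrow> y \<in> carr B \<Longrightarrow> impl B x y \<in> carr B"
  shows "heyting_algebra B"
proof -
  have hc: "h i x \<in> carr (A i)" if "i \<in> I" "x \<in> carr B" for i x
    using h[OF that(1)] that(2) by (auto simp: heyting_hom_def)
  have hs: "h i (zero B) = zero (A i)" "h i (one B) = one (A i)"
    "x \<in> carr B \<Longrightarrow> y \<in> carr B \<Longrightarrow> h i (meet B x y) = meet (A i) (h i x) (h i y)"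
    "x \<in> carr B \<Longrightarrow> y \<in> carr B \<Longrightarrow> h i (join B x y) = join (A i) (h i x) (h i y)"
    "x \<in> carr B \<Longrightarrow> y \<in> carr B \<Longrightarrow> h i (impl B x y) = impl (A i) (h i x) (h i y)"
    if "i \<in> I" for i x y
    using h[OF that] by (auto simp: heyting_hom_def)
  have eqI: "x = y \<longleftrightarrow> (\<forall>i\<in>I. h i x = h i y)" if "x \<in> carr B" "y \<in> carr B" for x y
    using that sep by blast
  note ax = heyting_assoc[OF A] heyting_absorb[OF A] heyting_bounds[OF A]
  have res: "le B (meet B x y) z \<longleftrightarrow> le B x (impl B y z)"
    if "x \<in> carr B" "y \<in> carr B" "z \<in> carr B" for x y z
  proof -
    have "h i (meet B (meet B x y) z) = h i (meet B x y) \<longleftrightarrow> h i (meet B x (impl B y z)) = h i x"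
      if i: "i \<in> I" for i
      using heyting_residuation[OF A[OF i] hc hc hc, OF i _ i _ i]
        \<open>x \<in> carr B\<close> \<open>y \<in> carr B\<close> \<open>z \<in> carr B\<close>
      by (simp add: hs[OF i] cl)
    then show ?thesis
      unfolding le_def using that by (simp add: eqI cl)
  qed
  show ?thesis
    unfolding heyting_algebra_def
  proof (intro conjI ballI)
    fix x y z assume xyz: "x \<in> carr B" "y \<in> carr B" "z \<in> carr B"
    note c = cl xyz
    show "meet B (meet B x y) z = meet B x (meet B y z)"
      by (rule sep) (use c in \<open>simp_all add: hs hc ax\<close>)
    show "join B (join B x y) z = join B x (join B y z)"
      by (rule sep) (use c in \<open>simp_all add: hs hc ax\<close>)
    show "le B (meet B x y) z \<longleftrightarrow> le B x (impl B y z)"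
      by (rule res) fact+
  next
    fix x y assume xy: "x \<in> carr B" "y \<in> carr B"
    note c = cl xy
    show "meet B x y = meet B y x"
      by (rule sep) (use c heyting_comm(1)[OF A hc hc] in \<open>simp_all add: hs\<close>)
    show "join B x y = join B y x"
      by (rule sep) (use c heyting_comm(2)[OF A hc hc] in \<open>simp_all add: hs\<close>)
    show "meet B x (join B x y) = x" "join B x (meet B x y) = x"
      by (rule sep; use c in \<open>simp add: hs hc ax\<close>)+
  next
    fix x assume x: "x \<in> carr B"
    note c = cl x
    show "le B (zero B) x" "le B x (one B)"
      unfolding le_def by (rule sep; use c in \<open>simp add: hs hc ax\<close>)+
  qed (use cl in auto)
qed

text \<open>Moving the structure of \<open>B\<close> along \<open>r\<close> replaces an algebra of
  functions, such as a product, by one on the type over which classes are formed.\<close>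

lemma isomorphic_copy:
  fixes r :: "'b \<Rightarrow> 'a"
  assumes "heyting_algebra B" "inj_on r (carr B)"
  shows "\<exists>A :: 'a heyting. heyting_algebra A \<and> isomorphic A B"
proof -
  define s where "s = the_inv_into (carr B) r"
  have s: "s (r x) = x" if "x \<in> carr B" for x
    using assms(2) that by (simp add: s_def the_inv_into_f_f)
  define A where "A = \<lparr>carr = r ` carr B,
      meet = \<lambda>x y. r (meet B (s x) (s y)), join = \<lambda>x y. r (join B (s x) (s y)),
      impl = \<lambda>x y. r (impl B (s x) (s y)), zero = r (zero B), one = r (one B)\<rparr>"
  have bij: "bij_betw s (carr A) (carr B)"
    using s by (force simp: A_def bij_betw_def inj_on_def image_iff)
  have hom: "heyting_hom s A B"
    using assms(1) by (auto simp: heyting_hom_def A_def s)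
  have "heyting_algebra A"
    by (rule heyting_algebra_of_homs[of UNIV "\<lambda>_::unit. B" "\<lambda>_. s"])
      (use assms(1) bij hom in \<open>auto simp: bij_betw_def inj_on_def A_def s\<close>)
  with bij hom show ?thesis
    unfolding isomorphic_iff by blast
qed

lemma forall_subalgebra_refl: "heyting_algebra A \<Longrightarrow> forall_subalgebra A A"
  by (auto simp: forall_subalgebra_def subalgebra_def)

lemma subalgebra_hom: "subalgebra A B \<Longrightarrow> heyting_hom (\<lambda>x. x) A B"
  by (auto simp: subalgebra_def heyting_hom_def)

section \<open>Soundness of the rule calculus\<close>

lemma validI:
  "(\<And>v. v \<in> valuations A \<Longrightarrow> (\<And>w \<gamma>. w \<in> variants A Q v \<Longrightarrow> \<gamma> \<in> \<Gamma> \<Longrightarrow> eval A w \<gamma> = one A) \<Longrightarrow>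
     eval A v \<psi> = one A) \<Longrightarrow> valid A (\<Gamma>, Q, \<psi>)"
  by (auto simp: valid_def)

lemma validD:
  "valid A (\<Gamma>, Q, \<psi>) \<Longrightarrow> v \<in> valuations A \<Longrightarrow>
    (\<And>w \<gamma>. w \<in> variants A Q v \<Longrightarrow> \<gamma> \<in> \<Gamma> \<Longrightarrow> eval A w \<gamma> = one A) \<Longrightarrow> eval A v \<psi> = one A"
  by (auto simp: valid_def)

lemma valid_axiom_iff: "valid A ({}, {}, \<chi>) \<longleftrightarrow> (\<forall>v\<in>valuations A. eval A v \<chi> = one A)"
  by (simp add: valid_def)

lemma valid_strong_reflexivity:
  assumes "heyting_algebra A" "\<phi> \<in> \<Gamma>" "\<And>i. i \<notin> Q \<Longrightarrow> \<sigma> i = Var i"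
  shows "valid A (\<Gamma>, Q, subst \<sigma> \<phi>)"
proof (rule validI)
  fix v assume v: "v \<in> valuations A"
    and prem: "\<And>w \<gamma>. w \<in> variants A Q v \<Longrightarrow> \<gamma> \<in> \<Gamma> \<Longrightarrow> eval A w \<gamma> = one A"
  \<comment> \<open>Substituting formulas for bound variables amounts to choosing values for them,
    so the premise covers the instance.\<close>
  have "(\<lambda>i. eval A v (\<sigma> i)) \<in> variants A Q v"
    using assms(1,3) v by (auto simp: variants_def valuations_def)
  then show "eval A v (subst \<sigma> \<phi>) = one A"
    using prem assms(2) by (simp add: eval_subst)
qed

lemma valid_monotonicity:
  assumes "valid A (\<Gamma>, Q, \<psi>)" "\<Gamma> \<subseteq> \<Gamma>'" "Q \<subseteq> Q'"
  shows "valid A (\<Gamma>', Q', \<psi>)"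
proof (rule validI)
  fix v assume v: "v \<in> valuations A"
    and prem: "\<And>w \<gamma>. w \<in> variants A Q' v \<Longrightarrow> \<gamma> \<in> \<Gamma>' \<Longrightarrow> eval A w \<gamma> = one A"
  have "variants A Q v \<subseteq> variants A Q' v"
    using assms(3) by (auto simp: variants_def)
  then show "eval A v \<psi> = one A"
    using validD[OF assms(1) v] prem assms(2) by blast
qed

lemma valid_alpha_renaming:
  assumes "valid A (\<Gamma>, Q, \<psi>)" "inj_on f Q" "f ` Q \<inter> ((\<Union>\<gamma>\<in>\<Gamma>. vars \<gamma>) - Q) = {}"
  shows "valid A (subst (\<lambda>i. Var (if i \<in> Q then f i else i)) ` \<Gamma>, f ` Q, \<psi>)"
proof (rule validI)
  fix v assume v: "v \<in> valuations A"
    and prem: "\<And>w \<gamma>. w \<in> variants A (f ` Q) v \<Longrightarrow>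
      \<gamma> \<in> subst (\<lambda>i. Var (if i \<in> Q then f i else i)) ` \<Gamma> \<Longrightarrow> eval A w \<gamma> = one A"
  show "eval A v \<psi> = one A"
  proof (rule validD[OF assms(1) v])
    fix w \<gamma> assume w: "w \<in> variants A Q v" and \<gamma>: "\<gamma> \<in> \<Gamma>"
    \<comment> \<open>\<open>u\<close> stores at \<open>f i\<close> the value that \<open>w\<close>
      gives to \<open>i\<close>. The new names avoid the free variables of \<open>\<gamma>\<close>,
      which therefore keep their values.\<close>
    define u where "u i = (if i \<in> f ` Q then w (the_inv_into Q f i) else v i)" for i
    have "u \<in> variants A (f ` Q) v"
      using w v by (auto simp: variants_def valuations_def u_def)
    then have "eval A u (subst (\<lambda>i. Var (if i \<in> Q then f i else i)) \<gamma>) = one A"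
      using prem \<gamma> by blast
    moreover have "u (f i) = w i" if "i \<in> Q" for i
      using that assms(2) by (simp add: u_def the_inv_into_f_f)
    moreover have "u i = w i" if "i \<notin> Q" "i \<in> vars \<gamma>" for i
      using that assms(3) \<gamma> w by (auto simp: u_def variants_def)
    ultimately show "eval A w \<gamma> = one A"
      by (subst (asm) eval_subst, subst eval_cong[of \<gamma> w]) auto
  qed
qed

lemma valid_rule_cut:
  assumes "\<And>\<delta>. \<delta> \<in> \<Delta> \<Longrightarrow> valid A (\<Gamma>, Q, \<delta>)" "valid A (\<Delta>, Q', \<psi>)"
    "Q' \<inter> ((\<Union>\<gamma>\<in>\<Gamma>. vars \<gamma>) - Q) = {}"
  shows "valid A (\<Gamma>, Q, \<psi>)"
proof (rule validI)
  fix v assume v: "v \<in> valuations A"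
    and prem: "\<And>w \<gamma>. w \<in> variants A Q v \<Longrightarrow> \<gamma> \<in> \<Gamma> \<Longrightarrow> eval A w \<gamma> = one A"
  show "eval A v \<psi> = one A"
  proof (rule validD[OF assms(2) v])
    fix w \<delta> assume w: "w \<in> variants A Q' v" and \<delta>: "\<delta> \<in> \<Delta>"
    show "eval A w \<delta> = one A"
    proof (rule validD[OF assms(1)[OF \<delta>] variants_valuations[OF w]])
      fix u \<gamma> assume u: "u \<in> variants A Q w" and \<gamma>: "\<gamma> \<in> \<Gamma>"
      \<comment> \<open>Outside \<open>Q\<close>, \<open>u\<close> can still differ from
        \<open>v\<close> on \<open>Q'\<close>. Resetting these variables is invisible to
        \<open>\<gamma>\<close>, whose free variables avoid \<open>Q'\<close>.\<close>
      have "(\<lambda>i. if i \<in> Q then u i else v i) \<in> variants A Q v"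
        using u v by (auto simp: variants_def valuations_def)
      from prem[OF this \<gamma>] show "eval A u \<gamma> = one A"
        using u w assms(3) \<gamma> by (subst eval_cong[of \<gamma> u]) (auto simp: variants_def)
    qed
  qed
qed

lemma valid_bound_structurality:
  assumes "heyting_algebra A" "valid A (\<Gamma>, Q, \<psi>)" "\<And>i. i \<in> Q \<Longrightarrow> \<sigma> i = Var i"
    "\<And>i. i \<notin> Q \<Longrightarrow> vars (\<sigma> i) \<inter> Q = {}"
  shows "valid A (subst \<sigma> ` \<Gamma>, Q, subst \<sigma> \<psi>)"
proof (rule validI)
  fix v assume v: "v \<in> valuations A"
    and prem: "\<And>w \<gamma>. w \<in> variants A Q v \<Longrightarrow> \<gamma> \<in> subst \<sigma> ` \<Gamma> \<Longrightarrow> eval A w \<gamma> = one A"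
  have v': "(\<lambda>i. eval A v (\<sigma> i)) \<in> valuations A"
    using assms(1) v by (simp add: valuations_def)
  show "eval A v (subst \<sigma> \<psi>) = one A"
    unfolding eval_subst
  proof (rule validD[OF assms(2) v'])
    fix w \<gamma> assume w: "w \<in> variants A Q (\<lambda>i. eval A v (\<sigma> i))" and \<gamma>: "\<gamma> \<in> \<Gamma>"
    \<comment> \<open>Since no formula substituted for a free variable mentions \<open>Q\<close>,
      choosing the bound values does not disturb the values of these formulas.\<close>
    define u where "u i = (if i \<in> Q then w i else v i)" for i
    have "u \<in> variants A Q v"
      using w v by (auto simp: variants_def valuations_def u_def)
    then have "eval A u (subst \<sigma> \<gamma>) = one A"
      using prem \<gamma> by blast
    moreover have "eval A u (\<sigma> i) = w i" for i
    proof (cases "i \<in> Q")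
      case True
      then show ?thesis using assms(3) by (simp add: u_def)
    next
      case False
      then have "eval A u (\<sigma> i) = eval A v (\<sigma> i)"
        using assms(4)[OF False] by (intro eval_cong) (auto simp: u_def)
      then show ?thesis using w False by (simp add: variants_def)
    qed
    ultimately show "eval A w \<gamma> = one A"
      by (simp add: eval_subst)
  qed
qed

lemma pi2_rule_system_Pi2:
  assumes "\<And>A. A \<in> K \<Longrightarrow> heyting_algebra A"
  shows "pi2_rule_system (Pi2 K)"
  unfolding pi2_rule_system_def
proof (intro conjI)
  show "Pi2 K \<subseteq> pi2_rules"
    by (auto simp: Pi2_def)
  show "strong_reflexivity (Pi2 K)"
    unfolding strong_reflexivity_def Pi2_def using valid_strong_reflexivity assms by blast
  show "monotonicity (Pi2 K)"
    unfolding monotonicity_def Pi2_def using valid_monotonicity by blast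
  show "alpha_renaming (Pi2 K)"
    unfolding alpha_renaming_def
  proof (intro allI impI)
    fix \<Gamma> Q \<psi> f
    assume R: "(\<Gamma>, Q, \<psi>) \<in> Pi2 K" "inj_on f Q" "f ` Q \<inter> (\<Union> (vars ` \<Gamma>) - Q) = {}"
      "f ` Q \<inter> vars \<psi> = {}"
    then have "(subst (\<lambda>i. Var (if i \<in> Q then f i else i)) ` \<Gamma>, f ` Q, \<psi>) \<in> pi2_rules"
      by (auto simp: Pi2_def pi2_rules_def)
    with R show "(subst (\<lambda>i. Var (if i \<in> Q then f i else i)) ` \<Gamma>, f ` Q, \<psi>) \<in> Pi2 K"
      using valid_alpha_renaming[OF _ R(2,3)] unfolding Pi2_def by blast
  qed
  show "rule_cut (Pi2 K)"
    unfolding rule_cut_def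
  proof (intro allI impI)
    fix \<Gamma> Q \<Delta> Q' \<psi>
    assume R: "\<forall>\<delta>\<in>\<Delta>. (\<Gamma>, Q, \<delta>) \<in> Pi2 K" "(\<Delta>, Q', \<psi>) \<in> Pi2 K"
      "Q' \<inter> (\<Union> (vars ` \<Gamma>) - Q) = {}" "(\<Gamma>, Q, \<psi>) \<in> pi2_rules"
    have "valid A (\<Gamma>, Q, \<psi>)" if "A \<in> K" for A
      by (rule valid_rule_cut[where \<Delta> = \<Delta>, OF _ _ R(3)]) (use R that in \<open>auto simp: Pi2_def\<close>)
    with R(4) show "(\<Gamma>, Q, \<psi>) \<in> Pi2 K"
      by (simp add: Pi2_def)
  qed
  show "bound_structurality (Pi2 K)"
    unfolding bound_structurality_def
  proof (intro allI impI)
    fix \<Gamma> Q \<psi> \<sigma>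
    assume R: "(\<Gamma>, Q, \<psi>) \<in> Pi2 K" "\<forall>i\<in>Q. \<sigma> i = Var i" "\<forall>i. i \<notin> Q \<longrightarrow> vars (\<sigma> i) \<inter> Q = {}"
    then have "(subst \<sigma> ` \<Gamma>, Q, subst \<sigma> \<psi>) \<in> pi2_rules"
      by (fastforce simp: Pi2_def pi2_rules_def vars_subst)
    moreover have "valid A (subst \<sigma> ` \<Gamma>, Q, subst \<sigma> \<psi>)" if "A \<in> K" for A
      by (rule valid_bound_structurality) (use R assms that in \<open>auto simp: Pi2_def\<close>)
    ultimately show "(subst \<sigma> ` \<Gamma>, Q, subst \<sigma> \<psi>) \<in> Pi2 K"
      by (simp add: Pi2_def)
  qed
qed

text \<open>Each closure condition survives intersection. That the result consists of rules depends
  on the intersected family being non-empty: the set of all rules belongs to it, being the rule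
  system of the empty class.\<close>

lemma pi2_rule_system_oplus: "pi2_rule_system (oplus S R)" if "S \<subseteq> pi2_rules" "R \<in> pi2_rules"
proof -
  have "pi2_rule_system (Pi2 ({} :: nat heyting set))"
    by (rule pi2_rule_system_Pi2) simp
  then have "pi2_rule_system pi2_rules"
    by (simp add: Pi2_def)
  then have "oplus S R \<subseteq> pi2_rules"
    using that by (auto simp: oplus_def)
  moreover have "strong_reflexivity (oplus S R)"
    unfolding strong_reflexivity_def oplus_def pi2_rule_system_def by blast
  moreover have "monotonicity (oplus S R)"
    unfolding monotonicity_def
  proof (intro allI impI)
    fix \<Gamma> Q \<psi> \<Gamma>' Q'
    assume a: "(\<Gamma>, Q, \<psi>) \<in> oplus S R" "\<Gamma> \<subseteq> \<Gamma>'" "Q \<subseteq> Q'" "(\<Gamma>', Q', \<psi>) \<in> pi2_rules"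
    show "(\<Gamma>', Q', \<psi>) \<in> oplus S R"
      unfolding oplus_def
    proof
      fix T assume T: "T \<in> {S'. pi2_rule_system S' \<and> S \<union> {R} \<subseteq> S'}"
      then have "monotonicity T" "(\<Gamma>, Q, \<psi>) \<in> T"
        using a(1) by (auto simp: pi2_rule_system_def oplus_def)
      then show "(\<Gamma>', Q', \<psi>) \<in> T"
        using a unfolding monotonicity_def by blast
    qed
  qed
  moreover have "alpha_renaming (oplus S R)"
    unfolding alpha_renaming_def
  proof (intro allI impI)
    fix \<Gamma> Q \<psi> f
    assume a: "(\<Gamma>, Q, \<psi>) \<in> oplus S R" "inj_on f Q" "f ` Q \<inter> (\<Union> (vars ` \<Gamma>) - Q) = {}"
      "f ` Q \<inter> vars \<psi> = {}"
    show "(subst (\<lambda>i. Var (if i \<in> Q then f i else i)) ` \<Gamma>, f ` Q, \<psi>) \<in> oplus S R"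
      unfolding oplus_def
    proof
      fix T assume T: "T \<in> {S'. pi2_rule_system S' \<and> S \<union> {R} \<subseteq> S'}"
      then have "alpha_renaming T" "(\<Gamma>, Q, \<psi>) \<in> T"
        using a(1) by (auto simp: pi2_rule_system_def oplus_def)
      then show "(subst (\<lambda>i. Var (if i \<in> Q then f i else i)) ` \<Gamma>, f ` Q, \<psi>) \<in> T"
        using a unfolding alpha_renaming_def by blast
    qed
  qed
  moreover have "rule_cut (oplus S R)"
    unfolding rule_cut_def
  proof (intro allI impI)
    fix \<Gamma> Q \<Delta> Q' \<psi>
    assume a: "\<forall>\<delta>\<in>\<Delta>. (\<Gamma>, Q, \<delta>) \<in> oplus S R" "(\<Delta>, Q', \<psi>) \<in> oplus S R"
      "Q' \<inter> (\<Union> (vars ` \<Gamma>) - Q) = {}" "(\<Gamma>, Q, \<psi>) \<in> pi2_rules"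
    show "(\<Gamma>, Q, \<psi>) \<in> oplus S R"
      unfolding oplus_def
    proof
      fix T assume T: "T \<in> {S'. pi2_rule_system S' \<and> S \<union> {R} \<subseteq> S'}"
      then have "rule_cut T" "\<forall>\<delta>\<in>\<Delta>. (\<Gamma>, Q, \<delta>) \<in> T" "(\<Delta>, Q', \<psi>) \<in> T"
        using a(1,2) by (auto simp: pi2_rule_system_def oplus_def)
      then show "(\<Gamma>, Q, \<psi>) \<in> T"
        using a(3,4) unfolding rule_cut_def by blast
    qed
  qed
  moreover have "bound_structurality (oplus S R)"
    unfolding bound_structurality_def
  proof (intro allI impI)
    fix \<Gamma> Q \<psi> \<sigma>
    assume a: "(\<Gamma>, Q, \<psi>) \<in> oplus S R" "\<forall>i\<in>Q. \<sigma> i = Var i" "\<forall>i. i \<notin> Q \<longrightarrow> vars (\<sigma> i) \<inter> Q = {}"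
    show "(subst \<sigma> ` \<Gamma>, Q, subst \<sigma> \<psi>) \<in> oplus S R"
      unfolding oplus_def
    proof
      fix T assume T: "T \<in> {S'. pi2_rule_system S' \<and> S \<union> {R} \<subseteq> S'}"
      then have "bound_structurality T" "(\<Gamma>, Q, \<psi>) \<in> T"
        using a(1) by (auto simp: pi2_rule_system_def oplus_def)
      then show "(subst \<sigma> ` \<Gamma>, Q, subst \<sigma> \<psi>) \<in> T"
        using a unfolding bound_structurality_def by blast
    qed
  qed
  ultimately show ?thesis
    by (simp add: pi2_rule_system_def)
qed

lemma oplus_superset: "S \<union> {R} \<subseteq> oplus S R"
  by (auto simp: oplus_def)

lemma oplus_least: "pi2_rule_system T \<Longrightarrow> S \<union> {R} \<subseteq> T \<Longrightarrow> oplus S R \<subseteq> T"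
  by (auto simp: oplus_def)

section \<open>Preservation of rules under isomorphisms and \<forall>-subalgebras\<close>

lemma valid_hom_iso:
  assumes A: "heyting_algebra A" and h: "bij_betw h (carr A) (carr B)" "heyting_hom h A B"
    and B: "valid B (\<Gamma>, Q, \<psi>)"
  shows "valid A (\<Gamma>, Q, \<psi>)"
proof (rule validI)
  have inj: "inj_on h (carr A)" using h(1) by (simp add: bij_betw_def)
  have one: "h x = one B \<longleftrightarrow> x = one A" if "x \<in> carr A" for x
    using inj_on_eq_iff[OF inj that heyting_closed(2)[OF A]] h(2) by (simp add: heyting_hom_def)
  fix v assume v: "v \<in> valuations A"
    and prem: "\<And>w \<gamma>. w \<in> variants A Q v \<Longrightarrow> \<gamma> \<in> \<Gamma> \<Longrightarrow> eval A w \<gamma> = one A"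
  have hv: "(\<lambda>i. h (v i)) \<in> valuations B"
    using v h(2) by (auto simp: valuations_def heyting_hom_def)
  have "eval B (\<lambda>i. h (v i)) \<psi> = one B"
  proof (rule validD[OF B hv])
    fix w \<gamma> assume w: "w \<in> variants B Q (\<lambda>i. h (v i))" and \<gamma>: "\<gamma> \<in> \<Gamma>"
    define u where "u i = the_inv_into (carr A) h (w i)" for i
    have wB: "w i \<in> h ` carr A" for i
      using w h(1) by (auto simp: variants_def valuations_def bij_betw_def)
    have uA: "u i \<in> carr A" and hu: "h (u i) = w i" for i
      using the_inv_into_into[OF inj wB] f_the_inv_into_f[OF inj wB] by (auto simp: u_def)
    have "u i = v i" if "i \<notin> Q" for i
      using w that v inj by (auto simp: u_def variants_def valuations_def the_inv_into_f_f)
    then have u: "u \<in> variants A Q v"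
      using uA by (simp add: variants_def valuations_def)
    show "eval B w \<gamma> = one B"
      using eval_hom[OF A h(2) variants_valuations[OF u], of \<gamma>] prem[OF u \<gamma>] h(2)
      by (simp add: hu heyting_hom_def)
  qed
  then show "eval A v \<psi> = one A"
    using eval_hom[OF A h(2) v] one A v by simp
qed

text \<open>Each premise is a universally quantified equation with parameters in \<open>A\<close>,
  which is what a \<forall>-subalgebra passes up to \<open>B\<close>. The conclusion has no
  quantifier and comes back down along the inclusion.\<close>

lemma valid_forall_subalgebra:
  assumes "forall_subalgebra A B" "valid B (\<Gamma>, Q, \<psi>)" "finite Q"
  shows "valid A (\<Gamma>, Q, \<psi>)"
proof (rule validI)
  have sub: "subalgebra A B" and A: "heyting_algebra A" and one: "one A = one B"
    using assms(1) by (auto simp: forall_subalgebra_def subalgebra_def)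
  note ev = eval_hom[OF A subalgebra_hom[OF sub]]
  fix v assume v: "v \<in> valuations A"
    and prem: "\<And>w \<gamma>. w \<in> variants A Q v \<Longrightarrow> \<gamma> \<in> \<Gamma> \<Longrightarrow> eval A w \<gamma> = one A"
  have vB: "v \<in> valuations B"
    using v sub by (auto simp: valuations_def subalgebra_def)
  have "eval B v \<psi> = one B"
  proof (rule validD[OF assms(2) vB])
    fix w \<gamma> assume w: "w \<in> variants B Q v" and \<gamma>: "\<gamma> \<in> \<Gamma>"
    have "sat_all_eq A Q v \<gamma> Top"
      using prem \<gamma> by (simp add: sat_all_eq_def)
    then have "sat_all_eq B Q v \<gamma> Top"
      using assms(1,3) v unfolding forall_subalgebra_def by blast
    then show "eval B w \<gamma> = one B"
      using w by (simp add: sat_all_eq_def)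
  qed
  then show "eval A v \<psi> = one A"
    using ev[OF v] one by simp
qed

lemma valid_copy_of_forall_subalgebra:
  assumes "copy_of_forall_subalgebra A B" "valid B R" "R \<in> pi2_rules"
  shows "valid A R"
  using assms valid_hom_iso valid_forall_subalgebra
  unfolding copy_of_forall_subalgebra_def isomorphic_iff pi2_rules_def by blast

section \<open>Products and ultraproducts\<close>

lemma direct_product_simps [simp]:
  "f \<in> carr (direct_product I A) \<longleftrightarrow> f \<in> (\<Pi>\<^sub>E i\<in>I. carr (A i))"
  "i \<in> I \<Longrightarrow> meet (direct_product I A) f g i = meet (A i) (f i) (g i)"
  "i \<in> I \<Longrightarrow> join (direct_product I A) f g i = join (A i) (f i) (g i)"
  "i \<in> I \<Longrightarrow> impl (direct_product I A) f g i = impl (A i) (f i) (g i)"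
  "i \<in> I \<Longrightarrow> zero (direct_product I A) i = zero (A i)"
  "i \<in> I \<Longrightarrow> one (direct_product I A) i = one (A i)"
  by (simp_all add: direct_product_def)

lemma direct_product_proj:
  "i \<in> I \<Longrightarrow> heyting_hom (\<lambda>f. f i) (direct_product I A) (A i)"
  by (auto simp: heyting_hom_def)

lemma direct_product_heyting:
  assumes "\<And>i. i \<in> I \<Longrightarrow> heyting_algebra (A i)"
  shows "heyting_algebra (direct_product I A)"
proof (rule heyting_algebra_of_homs[of I A "\<lambda>i f. f i"])
  fix x y assume "x \<in> carr (direct_product I A)" "y \<in> carr (direct_product I A)"
    "\<And>i. i \<in> I \<Longrightarrow> x i = y i"
  then show "x = y" by (auto intro: PiE_ext)
qed (use assms in \<open>auto simp: direct_product_proj, auto simp: direct_product_def PiE_iff\<close>)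

lemma eval_direct_product:
  "i \<in> I \<Longrightarrow> eval (direct_product I A) v \<phi> i = eval (A i) (\<lambda>j. v j i) \<phi>"
  by (induction \<phi>) auto

lemma eval_direct_product_eq_one_iff:
  assumes "\<And>i. i \<in> I \<Longrightarrow> heyting_algebra (A i)" "v \<in> valuations (direct_product I A)"
  shows "eval (direct_product I A) v \<phi> = one (direct_product I A) \<longleftrightarrow>
    (\<forall>i\<in>I. eval (A i) (\<lambda>j. v j i) \<phi> = one (A i))"
proof -
  have P: "heyting_algebra (direct_product I A)"
    by (rule direct_product_heyting) (rule assms(1))
  then have "eval (direct_product I A) v \<phi> \<in> (\<Pi>\<^sub>E i\<in>I. carr (A i))"
    "one (direct_product I A) \<in> (\<Pi>\<^sub>E i\<in>I. carr (A i))"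
    using eval_in_carr[OF P assms(2)] heyting_closed(2)[OF P] by simp_all
  then show ?thesis
    using PiE_ext[of _ I "\<lambda>i. carr (A i)" "one (direct_product I A)"]
    by (auto simp flip: eval_direct_product simp: direct_product_simps(6)[symmetric] simp del: direct_product_simps)
qed

lemma valid_direct_product:
  assumes A: "\<And>i. i \<in> I \<Longrightarrow> heyting_algebra (A i)" and R: "\<And>i. i \<in> I \<Longrightarrow> valid (A i) (\<Gamma>, Q, \<psi>)"
  shows "valid (direct_product I A) (\<Gamma>, Q, \<psi>)"
proof (rule validI)
  let ?P = "direct_product I A"
  fix v assume v: "v \<in> valuations ?P"
    and prem: "\<And>w \<gamma>. w \<in> variants ?P Q v \<Longrightarrow> \<gamma> \<in> \<Gamma> \<Longrightarrow> eval ?P w \<gamma> = one ?P"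
  have "eval (A i) (\<lambda>j. v j i) \<psi> = one (A i)" if i: "i \<in> I" for i
  proof (rule validD[OF R[OF i]])
    show "(\<lambda>j. v j i) \<in> valuations (A i)"
      using v i by (auto simp: valuations_def)
    fix w \<gamma> assume w: "w \<in> variants (A i) Q (\<lambda>j. v j i)" and \<gamma>: "\<gamma> \<in> \<Gamma>"
    \<comment> \<open>Altering \<open>v\<close> in coordinate \<open>i\<close> alone lifts a variant
      in the factor to a variant in the product. Hence premises true in the product are true in
      every factor.\<close>
    define u where "u j = (v j)(i := w j)" for j
    have "u \<in> variants ?P Q v"
      using v w i by (auto simp: variants_def valuations_def u_def PiE_iff extensional_def fun_eq_iff)
    from prem[OF this \<gamma>] have "eval (A i) (\<lambda>j. u j i) \<gamma> = one (A i)"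
      using eval_direct_product[OF i, of A u \<gamma>] i by simp
    then show "eval (A i) w \<gamma> = one (A i)"
      by (simp add: u_def)
  qed
  then show "eval ?P v \<psi> = one ?P"
    using eval_direct_product_eq_one_iff[OF A v] by blast
qed

section \<open>Extension to ultrafilters\<close>

lemma ultrafilter_extends_fip:
  assumes sub: "C \<subseteq> Pow I" and fip: "\<And>G. finite G \<Longrightarrow> G \<subseteq> C \<Longrightarrow> I \<inter> \<Inter>G \<noteq> {}"
  shows "\<exists>U. ultrafilter_on I U \<and> C \<subseteq> U"
proof -
  \<comment> \<open>Zorn's lemma is applied to the families with the finite intersection property
    that contain \<open>C\<close>. Intersecting with \<open>I\<close> handles the empty subfamily,
    for which \<open>\<Inter>{}\<close> is the whole type.\<close>
  define FF where "FF = {F. C \<subseteq> F \<and> F \<subseteq> Pow I \<and> (\<forall>G. finite G \<longrightarrow> G \<subseteq> F \<longrightarrow> I \<inter> \<Inter>G \<noteq> {})}"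
  have "C \<in> FF"
    using assms by (auto simp: FF_def)
  moreover have "\<Union>\<C> \<in> FF" if ne: "\<C> \<noteq> {}" and chain: "subset.chain FF \<C>" for \<C>
  proof -
    have sub\<C>: "\<C> \<subseteq> FF"
      using chain by (auto simp: subset.chain_def)
    have "I \<inter> \<Inter>G \<noteq> {}" if G: "finite G" "G \<subseteq> \<Union>\<C>" for G
    proof -
      obtain F where "F \<in> \<C>" "G \<subseteq> F"
        using finite_subset_Union_chain[OF G ne chain] by blast
      then show ?thesis
        using sub\<C> G(1) unfolding FF_def by blast
    qed
    moreover have "C \<subseteq> \<Union>\<C>"
      using sub\<C> ne by (force simp: FF_def)
    moreover have "\<Union>\<C> \<subseteq> Pow I"
      using sub\<C> by (force simp: FF_def)
    ultimately show ?thesis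
      by (simp add: FF_def)
  qed
  ultimately obtain U where U: "U \<in> FF" and max: "\<And>X. X \<in> FF \<Longrightarrow> U \<subseteq> X \<Longrightarrow> X = U"
    using subset_Zorn_nonempty[of FF] by blast
  have CU: "C \<subseteq> U" and UI: "U \<subseteq> Pow I" and Ufip: "\<And>G. finite G \<Longrightarrow> G \<subseteq> U \<Longrightarrow> I \<inter> \<Inter>G \<noteq> {}"
    using U by (simp_all add: FF_def)
  have ins: "Y \<in> U" if "Y \<subseteq> I" "\<And>H. finite H \<Longrightarrow> H \<subseteq> insert Y U \<Longrightarrow> I \<inter> \<Inter>H \<noteq> {}" for Y
  proof -
    have "insert Y U \<in> FF"
      using CU UI that by (auto simp: FF_def)
    then show ?thesis
      using max[of "insert Y U"] by blast
  qed
  \<comment> \<open>A set that includes a finite intersection of members can be added without losing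
    the property, so maximality puts it in \<open>U\<close>.\<close>
  have in_U: "Y \<in> U" if G: "finite G" "G \<subseteq> U" and Y: "I \<inter> \<Inter>G \<subseteq> Y" "Y \<subseteq> I" for G Y
  proof (rule ins[OF Y(2)])
    fix H assume H: "finite H" "H \<subseteq> insert Y U"
    have "I \<inter> \<Inter>(G \<union> (H - {Y})) \<noteq> {}"
      by (rule Ufip) (use G H in auto)
    then show "I \<inter> \<Inter>H \<noteq> {}" using Y(1) by blast
  qed
  \<comment> \<open>If \<open>X\<close> cannot be added, finitely many members of \<open>U\<close>
    meet only inside \<open>I - X\<close>, which is then a member itself.\<close>
  have compl: "X \<in> U \<or> I - X \<in> U" if X: "X \<subseteq> I" for X
  proof (rule disjCI)
    assume "I - X \<notin> U"
    show "X \<in> U"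
    proof (rule ins[OF X], rule notI)
      fix H assume H: "finite H" "H \<subseteq> insert X U" and "I \<inter> \<Inter>H = {}"
      then have "I \<inter> \<Inter>(H - {X}) \<subseteq> I - X"
        by blast
      moreover have "finite (H - {X})" "H - {X} \<subseteq> U"
        using H by auto
      ultimately show False
        using in_U[of "H - {X}" "I - X"] \<open>I - X \<notin> U\<close> by blast
    qed
  qed
  have "ultrafilter_on I U"
    unfolding ultrafilter_on_def
  proof (intro conjI ballI allI impI)
    show "U \<subseteq> Pow I" by (rule UI)
    show "I \<in> U" using in_U[of "{}"] by simp
    show "{} \<notin> U" using Ufip[of "{{}}"] by auto
  next
    fix X Y assume "X \<in> U" "Y \<in> U"
    then show "X \<inter> Y \<in> U" using in_U[of "{X, Y}"] UI by auto
  next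
    fix X Y assume "X \<in> U" "X \<subseteq> Y \<and> Y \<subseteq> I"
    then show "Y \<in> U" using in_U[of "{X}"] by auto
  next
    fix X assume "X \<subseteq> I"
    then show "X \<in> U \<or> I - X \<in> U" by (rule compl)
  qed
  then show ?thesis using CU by blast
qed

section \<open>Ultraproducts and the Los theorem for equations\<close>

locale ultra =
  fixes I :: "'i set" and U :: "'i set set" and A :: "'i \<Rightarrow> 'a heyting"
  assumes U: "ultrafilter_on I U" and A: "\<And>i. i \<in> I \<Longrightarrow> heyting_algebra (A i)"
begin

abbreviation "P \<equiv> direct_product I A"
abbreviation "M \<equiv> ultraproduct I U A"
abbreviation "cls f \<equiv> ultra_rel I U A `` {f}"
abbreviation "most p \<equiv> {i \<in> I. p i} \<in> U"

lemma most_mono: "most p \<Longrightarrow> (\<And>i. i \<in> I \<Longrightarrow> p i \<Longrightarrow> q i) \<Longrightarrow> most q"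
proof -
  assume "most p" "\<And>i. i \<in> I \<Longrightarrow> p i \<Longrightarrow> q i"
  moreover from this have "{i \<in> I. p i} \<subseteq> {i \<in> I. q i} \<and> {i \<in> I. q i} \<subseteq> I" by auto
  ultimately show ?thesis using U unfolding ultrafilter_on_def by blast
qed

lemma most_conj: assumes "most p" "most q" shows "most (\<lambda>i. p i \<and> q i)"
proof -
  have "{i \<in> I. p i} \<inter> {i \<in> I. q i} \<in> U"
    using U assms unfolding ultrafilter_on_def by blast
  moreover have "{i \<in> I. p i} \<inter> {i \<in> I. q i} = {i \<in> I. p i \<and> q i}" by auto
  ultimately show ?thesis by simp
qed

lemma most_all: "(\<And>i. i \<in> I \<Longrightarrow> p i) \<Longrightarrow> most p"
proof -
  assume "\<And>i. i \<in> I \<Longrightarrow> p i"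
  then have "{i \<in> I. p i} = I" by auto
  then show ?thesis using U by (simp add: ultrafilter_on_def)
qed

lemma most_not: "most (\<lambda>i. \<not> p i) \<longleftrightarrow> \<not> most p"
proof -
  have "{i \<in> I. \<not> p i} = I - {i \<in> I. p i}" by auto
  moreover have "{i \<in> I. p i} \<in> U \<or> I - {i \<in> I. p i} \<in> U"
    using U by (auto simp: ultrafilter_on_def)
  moreover have "\<not> (most p \<and> most (\<lambda>i. \<not> p i))"
    using most_conj[of p "\<lambda>i. \<not> p i"] U by (auto simp: ultrafilter_on_def)
  ultimately show ?thesis by auto
qed

lemma most_ball: "finite F \<Longrightarrow> (\<And>x. x \<in> F \<Longrightarrow> most (p x)) \<Longrightarrow> most (\<lambda>i. \<forall>x\<in>F. p x i)"
proof (induction F rule: finite_induct)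
  case empty
  show ?case by (rule most_all) simp
next
  case (insert x F)
  then have "most (\<lambda>i. p x i \<and> (\<forall>y\<in>F. p y i))" by (intro most_conj) auto
  then show ?case by simp
qed

lemma product_heyting: "heyting_algebra P"
  by (rule direct_product_heyting) (rule A)

lemma ultra_rel_iff:
  "(f, g) \<in> ultra_rel I U A \<longleftrightarrow> f \<in> carr P \<and> g \<in> carr P \<and> most (\<lambda>i. f i = g i)"
  by (simp add: ultra_rel_def)

lemma equiv_ultra_rel: "equiv (carr P) (ultra_rel I U A)"
proof (rule equivI)
  show "ultra_rel I U A \<subseteq> carr P \<times> carr P"
    by (auto simp: ultra_rel_def)
  show "refl_on (carr P) (ultra_rel I U A)"
    unfolding refl_on_def ultra_rel_iff using most_all[of "\<lambda>_. True"] by simp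
  show "sym (ultra_rel I U A)"
    by (auto simp: sym_def ultra_rel_iff elim: most_mono)
  show "trans (ultra_rel I U A)"
  proof (rule transI)
    fix f g h assume fgh: "(f, g) \<in> ultra_rel I U A" "(g, h) \<in> ultra_rel I U A"
    then have "most (\<lambda>i. f i = g i \<and> g i = h i)"
      unfolding ultra_rel_iff by (intro most_conj) blast+
    then have "most (\<lambda>i. f i = h i)" by (rule most_mono) simp
    with fgh show "(f, h) \<in> ultra_rel I U A" by (simp add: ultra_rel_iff)
  qed
qed

lemma cls_eq_iff:
  "f \<in> carr P \<Longrightarrow> g \<in> carr P \<Longrightarrow> cls f = cls g \<longleftrightarrow> most (\<lambda>i. f i = g i)"
  using eq_equiv_class_iff[OF equiv_ultra_rel, of f g] unfolding ultra_rel_iff by simp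

lemma carr_M: "carr M = cls ` carr P"
  by (auto simp: ultraproduct_def Let_def quotient_def)

text \<open>An operation of the ultraproduct collects the results on all representatives. Pointwise
  operations respect agreement on a set of \<open>U\<close>, and two such sets meet in a set of
  \<open>U\<close>, so all these results are equivalent.\<close>

lemma cls_op:
  assumes "f \<in> carr P" "g \<in> carr P"
    and op: "\<And>f g. f \<in> carr P \<Longrightarrow> g \<in> carr P \<Longrightarrow> op f g \<in> carr P"
    and opA: "\<And>f g i. i \<in> I \<Longrightarrow> op f g i = opA i (f i) (g i)"
  shows "ultra_rel I U A `` {op f' g' | f' g'. f' \<in> cls f \<and> g' \<in> cls g} = cls (op f g)"
proof -
  have cong: "cls (op f' g') = cls (op f g)" if "f' \<in> cls f" "g' \<in> cls g" for f' g'
  proof -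
    have *: "f' \<in> carr P" "g' \<in> carr P" "most (\<lambda>i. f i = f' i)" "most (\<lambda>i. g i = g' i)"
      using that unfolding Image_singleton_iff ultra_rel_iff by auto
    then have "most (\<lambda>i. op f' g' i = op f g i)"
      using most_conj[OF *(3,4)] by (elim most_mono) (auto simp: opA)
    then show ?thesis using * assms(1,2) op by (subst cls_eq_iff) auto
  qed
  have "f \<in> cls f" "g \<in> cls g"
    using equiv_class_self[OF equiv_ultra_rel] assms(1,2) by auto
  with cong show ?thesis by blast
qed

lemma M_ops:
  assumes "f \<in> carr P" "g \<in> carr P"
  shows "meet M (cls f) (cls g) = cls (meet P f g)"
    "join M (cls f) (cls g) = cls (join P f g)"
    "impl M (cls f) (cls g) = cls (impl P f g)"
proof -
  show "meet M (cls f) (cls g) = cls (meet P f g)"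
    using cls_op[OF assms heyting_closed(3)[OF product_heyting], where opA = "\<lambda>i. meet (A i)"]
    by (simp add: ultraproduct_def Let_def)
  show "join M (cls f) (cls g) = cls (join P f g)"
    using cls_op[OF assms heyting_closed(4)[OF product_heyting], where opA = "\<lambda>i. join (A i)"]
    by (simp add: ultraproduct_def Let_def)
  show "impl M (cls f) (cls g) = cls (impl P f g)"
    using cls_op[OF assms heyting_closed(5)[OF product_heyting], where opA = "\<lambda>i. impl (A i)"]
    by (simp add: ultraproduct_def Let_def)
qed

lemma M_bounds: "zero M = cls (zero P)" "one M = cls (one P)"
  by (simp_all add: ultraproduct_def Let_def)

text \<open>The Heyting identities carry over because \<open>M\<close> is a homomorphic image of
  \<open>P\<close>. Residuation carries over for another reason: its two equations hold at the same
  indices, so both hold on a set of \<open>U\<close> or neither does.\<close>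

lemma ultraproduct_heyting: "heyting_algebra M"
proof -
  note H = product_heyting
  note c = heyting_closed[OF H]
  have res: "meet M (meet M (cls f) (cls g)) (cls h) = meet M (cls f) (cls g) \<longleftrightarrow>
      meet M (cls f) (impl M (cls g) (cls h)) = cls f"
    if fgh: "f \<in> carr P" "g \<in> carr P" "h \<in> carr P" for f g h
  proof -
    have *: "i \<in> I \<Longrightarrow> meet (A i) (meet (A i) (f i) (g i)) (h i) = meet (A i) (f i) (g i) \<longleftrightarrow>
        meet (A i) (f i) (impl (A i) (g i) (h i)) = f i" for i
      using that by (intro heyting_residuation A) auto
    have "most (\<lambda>i. meet P (meet P f g) h i = meet P f g i) \<longleftrightarrow>
        most (\<lambda>i. meet P f (impl P g h) i = f i)"
      using * by (auto elim!: most_mono)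
    then show ?thesis
      using fgh c by (simp add: M_ops cls_eq_iff del: direct_product_simps)
  qed
  have comm: "meet M (cls f) (cls g) = meet M (cls g) (cls f)"
      "join M (cls f) (cls g) = join M (cls g) (cls f)"
    if "f \<in> carr P" "g \<in> carr P" for f g
    using that heyting_comm[OF H that] by (simp_all add: M_ops del: direct_product_simps)
  show ?thesis
    unfolding heyting_algebra_def le_def carr_M ball_simps M_bounds
  proof (intro conjI ballI)
    fix f g assume "f \<in> carr P" "g \<in> carr P"
    then show "meet M (cls f) (cls g) = meet M (cls g) (cls f)"
        "join M (cls f) (cls g) = join M (cls g) (cls f)"
      using comm by blast+
  qed (use c res in \<open>simp_all add: M_ops heyting_assoc[OF H] heyting_absorb[OF H]
        heyting_bounds[OF H] del: direct_product_simps\<close>)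
qed

lemma eval_M:
  assumes "\<And>j. f j \<in> carr P"
  shows "eval M (\<lambda>j. cls (f j)) \<phi> = cls (eval P f \<phi>) \<and> eval P f \<phi> \<in> carr P"
proof (induction \<phi>)
  case (Var i)
  then show ?case using assms by simp
next
  case (And \<phi> \<psi>)
  then show ?case
    using M_ops(1) heyting_closed(3)[OF product_heyting] by (simp del: direct_product_simps)
next
  case (Or \<phi> \<psi>)
  then show ?case
    using M_ops(2) heyting_closed(4)[OF product_heyting] by (simp del: direct_product_simps)
next
  case (Imp \<phi> \<psi>)
  then show ?case
    using M_ops(3) heyting_closed(5)[OF product_heyting] by (simp del: direct_product_simps)
qed (simp_all add: M_bounds heyting_closed[OF product_heyting] del: direct_product_simps)

text \<open>The Los theorem for equations: evaluation in \<open>M\<close> is carried out in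
  \<open>P\<close>, hence in each coordinate.\<close>

lemma eval_M_eq_iff:
  assumes "\<And>j. f j \<in> carr P"
  shows "eval M (\<lambda>j. cls (f j)) \<phi> = eval M (\<lambda>j. cls (f j)) \<psi> \<longleftrightarrow>
    most (\<lambda>i. eval (A i) (\<lambda>j. f j i) \<phi> = eval (A i) (\<lambda>j. f j i) \<psi>)"
proof -
  note ev = eval_M[where f = f, OF assms]
  have "eval M (\<lambda>j. cls (f j)) \<phi> = eval M (\<lambda>j. cls (f j)) \<psi> \<longleftrightarrow>
    most (\<lambda>i. eval P f \<phi> i = eval P f \<psi> i)"
    using cls_eq_iff[OF conjunct2[OF ev] conjunct2[OF ev]] conjunct1[OF ev] by simp
  also have "{i \<in> I. eval P f \<phi> i = eval P f \<psi> i} =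
    {i \<in> I. eval (A i) (\<lambda>j. f j i) \<phi> = eval (A i) (\<lambda>j. f j i) \<psi>}"
    by (auto simp: eval_direct_product)
  finally show ?thesis .
qed

lemma eval_M_eq_one_iff:
  assumes "\<And>j. f j \<in> carr P"
  shows "eval M (\<lambda>j. cls (f j)) \<phi> = one M \<longleftrightarrow> most (\<lambda>i. eval (A i) (\<lambda>j. f j i) \<phi> = one (A i))"
  using eval_M_eq_iff[where f = f and \<phi> = \<phi> and \<psi> = Top] assms unfolding eval.simps by blast

lemma valuation_M:
  assumes "v \<in> valuations M"
  obtains f where "\<And>j. f j \<in> carr P" "v = (\<lambda>j. cls (f j))"
proof -
  have "\<forall>j. \<exists>g. g \<in> carr P \<and> v j = cls g"
    using assms unfolding valuations_def carr_M by blast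
  then obtain f where "\<forall>j. f j \<in> carr P \<and> v j = cls (f j)"
    by metis
  then have "\<And>j. f j \<in> carr P" "v = (\<lambda>j. cls (f j))"
    by (simp_all add: fun_eq_iff del: direct_product_simps)
  then show ?thesis by (rule that)
qed

lemma valuation_A: "(\<And>j. f j \<in> carr P) \<Longrightarrow> i \<in> I \<Longrightarrow> (\<lambda>j. f j i) \<in> valuations (A i)"
  by (auto simp: valuations_def)

text \<open>If the conclusion fails in \<open>M\<close>, it fails at almost all indices, and each of
  these has a bound assignment violating some premise. Glued together, these assignments form a
  variant in \<open>M\<close>, where all premises hold. Since \<open>\<Gamma>\<close> is finite,
  almost all indices satisfy the premises simultaneously, and one of them is a violating
  index.\<close>

lemma valid_ultraproduct:
  assumes R: "\<And>i. i \<in> I \<Longrightarrow> valid (A i) (\<Gamma>, Q, \<psi>)" and fin: "finite \<Gamma>"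
  shows "valid M (\<Gamma>, Q, \<psi>)"
proof (rule validI, rule ccontr)
  fix v assume "v \<in> valuations M"
    and prem: "\<And>w \<gamma>. w \<in> variants M Q v \<Longrightarrow> \<gamma> \<in> \<Gamma> \<Longrightarrow> eval M w \<gamma> = one M"
    and neg: "eval M v \<psi> \<noteq> one M"
  from \<open>v \<in> valuations M\<close> obtain f where f: "\<And>j. f j \<in> carr P" and v: "v = (\<lambda>j. cls (f j))"
    using valuation_M by blast
  define bad where "bad i \<longleftrightarrow> eval (A i) (\<lambda>j. f j i) \<psi> \<noteq> one (A i)" for i
  have bad: "most bad"
    using neg f by (simp add: v eval_M_eq_one_iff most_not bad_def)
  have "\<exists>w\<in>variants (A i) Q (\<lambda>j. f j i). bad i \<longrightarrow> (\<exists>\<gamma>\<in>\<Gamma>. eval (A i) w \<gamma> \<noteq> one (A i))"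
    if i: "i \<in> I" for i
  proof (cases "bad i")
    case True
    then show ?thesis
      using validD[OF R[OF i] valuation_A[where f = f, OF f i]] unfolding bad_def by blast
  next
    \<comment> \<open>Where the conclusion holds, the unchanged valuation serves as default, so that
      the choice is total.\<close>
    case False
    then show ?thesis
      using valuation_A[where f = f, OF f i] by (auto simp: variants_def)
  qed
  then obtain w where w: "\<And>i. i \<in> I \<Longrightarrow> w i \<in> variants (A i) Q (\<lambda>j. f j i)"
    and wbad: "\<And>i. i \<in> I \<Longrightarrow> bad i \<Longrightarrow> \<exists>\<gamma>\<in>\<Gamma>. eval (A i) (w i) \<gamma> \<noteq> one (A i)"
    by metis
  define g where "g j = (\<lambda>i\<in>I. w i j)" for j
  have g: "g j \<in> carr P" for j
    using w by (auto simp: g_def variants_def valuations_def)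
  have "g j = f j" if "j \<notin> Q" for j
  proof (rule PiE_ext)
    show "g j \<in> (\<Pi>\<^sub>E i\<in>I. carr (A i))" "f j \<in> (\<Pi>\<^sub>E i\<in>I. carr (A i))"
      using f[of j] g[of j] by auto
    show "\<And>i. i \<in> I \<Longrightarrow> g j i = f j i"
      using w that by (auto simp: g_def variants_def)
  qed
  then have "(\<lambda>j. cls (g j)) \<in> variants M Q v"
    using g by (auto simp: variants_def valuations_def v carr_M simp del: direct_product_simps)
  then have "most (\<lambda>i. eval (A i) (\<lambda>j. g j i) \<gamma> = one (A i))" if "\<gamma> \<in> \<Gamma>" for \<gamma>
    using prem that eval_M_eq_one_iff[of g] g by blast
  then have "most (\<lambda>i. \<forall>\<gamma>\<in>\<Gamma>. eval (A i) (\<lambda>j. g j i) \<gamma> = one (A i))"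
    by (rule most_ball[OF fin])
  with bad have "most (\<lambda>i. bad i \<and> (\<forall>\<gamma>\<in>\<Gamma>. eval (A i) (\<lambda>j. g j i) \<gamma> = one (A i)))"
    by (rule most_conj)
  then have "most (\<lambda>_. False)"
    by (rule most_mono) (use wbad in \<open>auto simp: g_def\<close>)
  then show False
    using U by (simp add: ultrafilter_on_def)
qed

end

section \<open>Inductive rule classes are axiomatized by their rules\<close>

text \<open>Codes of formulas cut the diagram of an algebra into finite pieces, and they place the
  free algebra inside an arbitrary infinite type.\<close>

instance fm :: countable
  by countable_datatype

lemma infinite_inj_pair:
  assumes "infinite (UNIV :: 'a set)"
  shows "\<exists>p :: 'a \<times> 'a \<Rightarrow> 'a. inj p"
proof -
  have "\<exists>f. bij_betw f ((UNIV :: 'a set) \<times> (UNIV :: 'a set)) (UNIV :: 'a set)"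
    using card_of_Times_same_infinite[OF assms] by (simp add: card_of_ordIso)
  then show ?thesis
    by (auto simp: bij_betw_def)
qed

lemma infinite_inj_list_nat:
  assumes "infinite (UNIV :: 'a set)"
  shows "\<exists>g :: 'a list \<times> nat \<Rightarrow> 'a. inj g"
proof -
  obtain p :: "'a \<times> 'a \<Rightarrow> 'a" where p: "inj p"
    using infinite_inj_pair[OF assms] by blast
  obtain c :: "nat \<Rightarrow> 'a" where c: "inj c"
    using infinite_countable_subset[OF assms] by blast
  define enc where "enc xs = foldr (\<lambda>x r. p (x, r)) xs (c 0)" for xs
  \<comment> \<open>The end mark \<open>c 0\<close> may itself be the code of a pair, so only lists
    of equal length are separated; the final map records the length as well.\<close>
  have enc: "length xs = length ys \<Longrightarrow> enc xs = enc ys \<Longrightarrow> xs = ys" for xs ys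
    by (induction xs ys rule: list_induct2) (use p in \<open>auto simp: enc_def dest: injD\<close>)
  have "inj (\<lambda>(xs, n). p (c (length xs), p (enc xs, c n)))"
    using enc by (auto intro!: injI simp: inj_eq[OF p] inj_eq[OF c])
  then show ?thesis by blast
qed

lemma inductive_rule_class_members:
  assumes K: "inductive_rule_class TYPE('i) K" and A: "A \<in> K"
  shows "heyting_algebra A" "godel_algebra A" "nondegenerate A"
proof -
  have "\<forall>A\<in>K. godel_algebra A \<and> nondegenerate A"
    using K unfolding inductive_rule_class_def by (elim conjE)
  with A show "heyting_algebra A" "godel_algebra A" "nondegenerate A"
    by (simp_all add: godel_algebra_def)
qed

lemma inductive_rule_class_copy:
  assumes K: "inductive_rule_class TYPE('i) K" and A: "A \<in> K" "copy_of_forall_subalgebra B A"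
  shows "B \<in> K"
proof -
  have "\<forall>A\<in>K. \<forall>B. copy_of_forall_subalgebra B A \<longrightarrow> B \<in> K"
    using K unfolding inductive_rule_class_def by (elim conjE)
  with A show ?thesis by blast
qed

lemma inductive_rule_class_product:
  fixes I :: "'i set"
  assumes K: "inductive_rule_class TYPE('i) K" and A: "I \<noteq> {}" "\<And>i. i \<in> I \<Longrightarrow> A i \<in> K"
    "copy_of_forall_subalgebra B (direct_product I A)"
  shows "B \<in> K"
proof -
  have "\<forall>(I :: 'i set) A B. I \<noteq> {} \<longrightarrow> (\<forall>i\<in>I. A i \<in> K) \<longrightarrow>
      copy_of_forall_subalgebra B (direct_product I A) \<longrightarrow> B \<in> K"
    using K unfolding inductive_rule_class_def by (elim conjE)
  with A show ?thesis by blast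
qed

lemma inductive_rule_class_ultraproduct:
  fixes I :: "'i set"
  assumes K: "inductive_rule_class TYPE('i) K" and A: "ultrafilter_on I U" "\<And>i. i \<in> I \<Longrightarrow> A i \<in> K"
    "copy_of_forall_subalgebra B (ultraproduct I U A)"
  shows "B \<in> K"
proof -
  have "\<forall>(I :: 'i set) U A B. ultrafilter_on I U \<longrightarrow> (\<forall>i\<in>I. A i \<in> K) \<longrightarrow>
      copy_of_forall_subalgebra B (ultraproduct I U A) \<longrightarrow> B \<in> K"
    using K unfolding inductive_rule_class_def by (elim conjE)
  with A show ?thesis by blast
qed

text \<open>\<open>D\<close> is a copy of the product of \<open>B\<close> and \<open>C\<close>
  inside \<open>'a\<close>, with projections \<open>p\<close> and \<open>q\<close>. Describing it by
  jointly injective, jointly onto homomorphisms hides the function type of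
  \<open>direct_product\<close>.\<close>

lemma binary_product_in_class:
  fixes K :: "'a heyting set" and e :: "'a \<Rightarrow> 'i"
  assumes inf: "infinite (UNIV :: 'a set)" and e: "inj e"
    and K: "inductive_rule_class TYPE('i) K" and B: "B \<in> K" and C: "C \<in> K"
  shows "\<exists>D\<in>K. \<exists>p q. heyting_hom p D B \<and> heyting_hom q D C \<and>
    (\<forall>x\<in>carr D. \<forall>y\<in>carr D. p x = p y \<longrightarrow> q x = q y \<longrightarrow> x = y) \<and>
    (\<forall>b\<in>carr B. \<forall>c\<in>carr C. \<exists>d\<in>carr D. p d = b \<and> q d = c)"
proof -
  obtain a1 a2 :: 'a where "a1 \<noteq> a2"
    using inf by (metis (full_types) UNIV_I finite.simps finite_subset insert_iff subsetI)
  define i1 i2 where "i1 = e a1" and "i2 = e a2"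
  have i12: "i1 \<noteq> i2"
    using e \<open>a1 \<noteq> a2\<close> by (auto simp: i1_def i2_def dest: injD)
  define I where "I = {i1, i2}"
  define A where "A i = (if i = i1 then B else C)" for i
  let ?P = "direct_product I A"
  have AK: "A i \<in> K" for i
    using B C by (simp add: A_def)
  have P: "heyting_algebra ?P"
    using AK inductive_rule_class_members(1)[OF K] by (intro direct_product_heyting) auto
  obtain pr :: "'a \<times> 'a \<Rightarrow> 'a" where pr: "inj pr"
    using infinite_inj_pair[OF inf] by blast
  have ext: "f = g" if "f \<in> carr ?P" "g \<in> carr ?P" "f i1 = g i1" "f i2 = g i2" for f g
    using that by (intro PiE_ext[of f I "\<lambda>i. carr (A i)" g]) (auto simp: I_def)
  have "inj_on (\<lambda>f. pr (f i1, f i2)) (carr ?P)"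
    using pr ext by (auto intro!: inj_onI dest!: injD simp del: direct_product_simps)
  then obtain D :: "'a heyting" where D: "heyting_algebra D" "isomorphic D ?P"
    using isomorphic_copy[OF P] by blast
  then obtain h where h: "bij_betw h (carr D) (carr ?P)" "heyting_hom h D ?P"
    by (auto simp: isomorphic_iff)
  have "copy_of_forall_subalgebra D ?P"
    using D forall_subalgebra_refl[OF P] by (auto simp: copy_of_forall_subalgebra_def)
  moreover have "I \<noteq> {}" by (simp add: I_def)
  ultimately have DK: "D \<in> K"
    using inductive_rule_class_product[OF K, of I A] AK by blast
  have hom: "heyting_hom (\<lambda>x. h x i) D (A i)" if "i \<in> I" for i
    using h(2) direct_product_proj[OF that, of A] unfolding heyting_hom_def by (simp add: image_subset_iff)
  have homs: "heyting_hom (\<lambda>x. h x i1) D B" "heyting_hom (\<lambda>x. h x i2) D C"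
    using i12 hom[of i1] hom[of i2] by (auto simp: I_def A_def)
  have inj: "x = y" if "x \<in> carr D" "y \<in> carr D" "h x i1 = h y i1" "h x i2 = h y i2" for x y
  proof -
    have "h x \<in> carr ?P" "h y \<in> carr ?P"
      using h(1) that(1,2) by (auto simp: bij_betw_def simp del: direct_product_simps)
    then have "h x = h y" using ext that(3,4) by blast
    then show ?thesis using h(1) that(1,2) by (auto simp: bij_betw_def dest: inj_onD)
  qed
  have surj: "\<exists>d\<in>carr D. h d i1 = b \<and> h d i2 = c" if "b \<in> carr B" "c \<in> carr C" for b c
  proof -
    have "(\<lambda>i\<in>I. if i = i1 then b else c) \<in> carr ?P"
      using that by (auto simp: A_def)
    then obtain d where "d \<in> carr D" "h d = (\<lambda>i\<in>I. if i = i1 then b else c)"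
      using h(1) unfolding bij_betw_def by (metis imageE)
    then show ?thesis using i12 by (intro bexI[of _ d]) (auto simp: I_def)
  qed
  show ?thesis
    using DK homs inj surj by blast
qed

text \<open>In a product the premises hold because every variant projects to a variant in each
  factor, and a formula fails as soon as it fails in one factor. So the product of a countermodel
  for \<open>\<psi>\<close> with one for the remaining conclusions refutes them all.\<close>

lemma joint_refutation:
  fixes K :: "'a heyting set" and e :: "'a \<Rightarrow> 'i"
  assumes inf: "infinite (UNIV :: 'a set)" and e: "inj e"
    and K: "inductive_rule_class TYPE('i) K"
    and fin: "finite \<Psi>" "\<Psi> \<noteq> {}"
    and ref: "\<And>\<psi>. \<psi> \<in> \<Psi> \<Longrightarrow> \<exists>B\<in>K. \<exists>v\<in>valuations B.
      (\<forall>w\<in>variants B Q v. \<forall>\<gamma>\<in>\<Gamma>. eval B w \<gamma> = one B) \<and> eval B v \<psi> \<noteq> one B"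
  shows "\<exists>B\<in>K. \<exists>v\<in>valuations B.
      (\<forall>w\<in>variants B Q v. \<forall>\<gamma>\<in>\<Gamma>. eval B w \<gamma> = one B) \<and> (\<forall>\<psi>\<in>\<Psi>. eval B v \<psi> \<noteq> one B)"
  using fin ref
proof (induction \<Psi> rule: finite_ne_induct)
  case (singleton \<psi>)
  then show ?case by simp
next
  case (insert \<psi> \<Psi>)
  obtain B v where B: "B \<in> K" "v \<in> valuations B"
    "\<And>w \<gamma>. w \<in> variants B Q v \<Longrightarrow> \<gamma> \<in> \<Gamma> \<Longrightarrow> eval B w \<gamma> = one B" "eval B v \<psi> \<noteq> one B"
    using insert.prems[of \<psi>] by auto
  obtain C v' where C: "C \<in> K" "v' \<in> valuations C"
    "\<And>w \<gamma>. w \<in> variants C Q v' \<Longrightarrow> \<gamma> \<in> \<Gamma> \<Longrightarrow> eval C w \<gamma> = one C" "\<forall>\<psi>\<in>\<Psi>. eval C v' \<psi> \<noteq> one C"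
    using insert.IH insert.prems by auto
  obtain D p q where D: "D \<in> K" and hom: "heyting_hom p D B" "heyting_hom q D C"
    and inj: "\<And>x y. x \<in> carr D \<Longrightarrow> y \<in> carr D \<Longrightarrow> p x = p y \<Longrightarrow> q x = q y \<Longrightarrow> x = y"
    and surj: "\<And>b c. b \<in> carr B \<Longrightarrow> c \<in> carr C \<Longrightarrow> \<exists>d\<in>carr D. p d = b \<and> q d = c"
    using binary_product_in_class[OF inf e K B(1) C(1)] by blast
  have H: "heyting_algebra D"
    using inductive_rule_class_members(1)[OF K D] .
  have "\<exists>d\<in>carr D. p d = v j \<and> q d = v' j" for j
    using surj B(2) C(2) by (simp add: valuations_def)
  then obtain u where u: "\<And>j. u j \<in> carr D" "\<And>j. p (u j) = v j" "\<And>j. q (u j) = v' j"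
    by metis
  then have uD: "u \<in> valuations D" by (simp add: valuations_def)
  have one: "p (one D) = one B" "q (one D) = one C"
    using hom by (auto simp: heyting_hom_def)
  have "eval D w \<gamma> = one D" if w: "w \<in> variants D Q u" and \<gamma>: "\<gamma> \<in> \<Gamma>" for w \<gamma>
  proof (rule inj)
    have wD: "w \<in> valuations D" using w by (rule variants_valuations)
    show "eval D w \<gamma> \<in> carr D" "one D \<in> carr D" using H wD by auto
    have "(\<lambda>j. p (w j)) \<in> variants B Q v" "(\<lambda>j. q (w j)) \<in> variants C Q v'"
      using w hom u by (auto simp: variants_def valuations_def heyting_hom_def)
    then have "eval B (\<lambda>j. p (w j)) \<gamma> = one B" "eval C (\<lambda>j. q (w j)) \<gamma> = one C"
      using B(3) C(3) \<gamma> by blast+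
    then show "p (eval D w \<gamma>) = p (one D)" "q (eval D w \<gamma>) = q (one D)"
      using eval_hom[OF H hom(1) wD] eval_hom[OF H hom(2) wD] one by simp_all
  qed
  moreover have "eval D u \<chi> \<noteq> one D" if "\<chi> \<in> insert \<psi> \<Psi>" for \<chi>
    using that B(4) C(4) eval_hom[OF H hom(1) uD] eval_hom[OF H hom(2) uD] one u by auto
  ultimately show ?case
    using D uD by blast
qed

text \<open>Even variables name the parameters listed in \<^term>\<open>bs\<close>, odd variables are bound. The number
  \<^term>\<open>n\<close> bounds the codes of the formulas considered, which keeps the part of the diagram finite;
  only formulas whose parameters are listed matter, so \<^term>\<open>pos\<close> may take junk values elsewhere.\<close>

definition pos :: "'a list \<Rightarrow> 'a \<Rightarrow> nat" where
  "pos bs a = (LEAST k. k < length bs \<and> bs ! k = a)"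

lemma pos: "a \<in> set bs \<Longrightarrow> pos bs a < length bs \<and> bs ! pos bs a = a"
  unfolding pos_def by (rule LeastI_ex) (auto simp: in_set_conv_nth)

definition name_params :: "'a list \<Rightarrow> nat set \<Rightarrow> (nat \<Rightarrow> 'a) \<Rightarrow> fm \<Rightarrow> fm" where
  "name_params bs X v = subst (\<lambda>j. Var (if j \<in> X then 2 * j + 1 else 2 * pos bs (v j)))"

text \<open>Universal statements must be preserved because the copy of \<open>A\<close> is to be a
  \<forall>-subalgebra; inequations enter without quantifiers, to make the embedding
  injective.\<close>

definition diagram_model :: "'a heyting \<Rightarrow> 'a list \<Rightarrow> nat \<Rightarrow> 'b heyting \<Rightarrow> ('a \<Rightarrow> 'b) \<Rightarrow> bool" where
  "diagram_model A bs n B h \<longleftrightarrow> (\<forall>a. h a \<in> carr B) \<and>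
    (\<forall>\<phi> X v. v \<in> valuations A \<longrightarrow> v ` (vars \<phi> - X) \<subseteq> set bs \<longrightarrow> to_nat (name_params bs X v \<phi>) < n \<longrightarrow>
       ((\<forall>u\<in>variants A X v. eval A u \<phi> = one A) \<longrightarrow>
        (\<forall>u\<in>variants B X (\<lambda>j. h (v j)). eval B u \<phi> = one B)) \<and>
       (X = {} \<longrightarrow> eval A v \<phi> \<noteq> one A \<longrightarrow> eval B (\<lambda>j. h (v j)) \<phi> \<noteq> one B))"

lemma diagram_modelD:
  assumes "diagram_model A bs n B h"
  shows "h a \<in> carr B"
    "v \<in> valuations A \<Longrightarrow> v ` (vars \<phi> - X) \<subseteq> set bs \<Longrightarrow> to_nat (name_params bs X v \<phi>) < n \<Longrightarrow>
      \<forall>u\<in>variants A X v. eval A u \<phi> = one A \<Longrightarrow> u \<in> variants B X (\<lambda>j. h (v j)) \<Longrightarrow>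
      eval B u \<phi> = one B"
    "v \<in> valuations A \<Longrightarrow> v ` vars \<phi> \<subseteq> set bs \<Longrightarrow> to_nat (name_params bs {} v \<phi>) < n \<Longrightarrow>
      eval A v \<phi> \<noteq> one A \<Longrightarrow> eval B (\<lambda>j. h (v j)) \<phi> \<noteq> one B"
proof -
  note model = assms[unfolded diagram_model_def]
  show "h a \<in> carr B"
    using model by simp
  note ax = spec[OF spec[OF spec[OF conjunct2[OF model]]]]
  show "v \<in> valuations A \<Longrightarrow> v ` (vars \<phi> - X) \<subseteq> set bs \<Longrightarrow> to_nat (name_params bs X v \<phi>) < n \<Longrightarrow>
      \<forall>u\<in>variants A X v. eval A u \<phi> = one A \<Longrightarrow> u \<in> variants B X (\<lambda>j. h (v j)) \<Longrightarrow>
      eval B u \<phi> = one B"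
    using ax[of v \<phi> X] by simp
  show "v \<in> valuations A \<Longrightarrow> v ` vars \<phi> \<subseteq> set bs \<Longrightarrow> to_nat (name_params bs {} v \<phi>) < n \<Longrightarrow>
      eval A v \<phi> \<noteq> one A \<Longrightarrow> eval B (\<lambda>j. h (v j)) \<phi> \<noteq> one B"
    using ax[of v \<phi> "{}"] by simp
qed

text \<open>The premises are the universal formulas of the finite diagram that are true in
  \<open>A\<close>, the conclusion is one that is false. \<open>A\<close> refutes this rule at the
  valuation naming the parameters, so the rule is not in \<open>Pi2 K\<close> and some member of
  \<open>K\<close> refutes it too. One member for all conclusions comes from
  \<open>joint_refutation\<close>.\<close>

lemma finite_diagram_model:
  fixes K :: "'a heyting set" and e :: "'a \<Rightarrow> 'i"
  assumes inf: "infinite (UNIV :: 'a set)" and e: "inj e"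
    and K: "inductive_rule_class TYPE('i) K"
    and A: "heyting_algebra A" "nondegenerate A" "\<And>R. R \<in> Pi2 K \<Longrightarrow> valid A R"
    and bs: "set bs \<subseteq> carr A"
  shows "\<exists>B\<in>K. \<exists>h. diagram_model A bs n B h"
proof -
  \<comment> \<open>Variables \<open>2 * p\<close> and \<open>2 * p + 1\<close> both receive the
    parameter at position \<open>p\<close>. Only the even values count, since odd variables get
    reassigned; \<open>zero A\<close> is the default beyond the list.\<close>
  define val where "val k = (if k div 2 < length bs then bs ! (k div 2) else zero A)" for k
  have valA: "val \<in> valuations A"
    using bs A(1) by (auto simp: val_def valuations_def)
  have val_pos: "val (2 * pos bs a) = a" if "a \<in> set bs" for a
    using pos[OF that] by (simp add: val_def)
  have fin: "finite {\<phi> :: fm. to_nat \<phi> < n}"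
    using finite_vimageI[OF finite_lessThan[of n] inj_to_nat[where 'a = fm]] by (simp add: vimage_def)
  define Od where "Od = {k :: nat. odd k}"
  define \<Gamma> where "\<Gamma> = {\<phi>. to_nat \<phi> < n \<and> (\<forall>u\<in>variants A Od val. eval A u \<phi> = one A)}"
  \<comment> \<open>A conclusion may not contain bound variables, hence no odd ones.
    \<open>Bot\<close> keeps the set non-empty, and \<open>A\<close> refutes it by
    nondegeneracy.\<close>
  define \<Psi> where "\<Psi> = insert Bot {\<phi>. to_nat \<phi> < n \<and> eval A val \<phi> \<noteq> one A \<and> vars \<phi> \<inter> Od = {}}"
  \<comment> \<open>A rule binds only finitely many variables, so \<open>Od\<close> is cut down to
    those occurring in premises. The fact \<open>pos_B'\<close> recovers quantification over all of
    \<open>Od\<close>.\<close>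
  define Q where "Q = Od \<inter> (\<Union>\<phi>\<in>\<Gamma>. vars \<phi>)"
  have fin\<Gamma>: "finite \<Gamma>" and fin\<Psi>: "finite \<Psi>"
    using fin by (auto simp: \<Gamma>_def \<Psi>_def)
  then have finQ: "finite Q" by (auto simp: Q_def)
  have "\<exists>B\<in>K. \<exists>v\<in>valuations B.
      (\<forall>w\<in>variants B Q v. \<forall>\<gamma>\<in>\<Gamma>. eval B w \<gamma> = one B) \<and> eval B v \<psi> \<noteq> one B" if \<psi>: "\<psi> \<in> \<Psi>" for \<psi>
  proof -
    have rule: "(\<Gamma>, Q, \<psi>) \<in> pi2_rules"
      using \<psi> fin\<Gamma> finQ by (auto simp: pi2_rules_def \<Psi>_def Q_def)
    have "eval A val \<psi> \<noteq> one A"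
      using \<psi> A(2) by (auto simp: \<Psi>_def nondegenerate_def)
    moreover have "eval A w \<gamma> = one A" if "w \<in> variants A Q val" "\<gamma> \<in> \<Gamma>" for w \<gamma>
      using that by (auto simp: \<Gamma>_def Q_def variants_def)
    ultimately have "\<not> valid A (\<Gamma>, Q, \<psi>)"
      using validD[OF _ valA] by blast
    then have "(\<Gamma>, Q, \<psi>) \<notin> Pi2 K" using A(3) by blast
    then obtain B where B: "B \<in> K" "\<not> valid B (\<Gamma>, Q, \<psi>)"
      using rule by (auto simp: Pi2_def)
    then show ?thesis unfolding valid_def by blast
  qed
  moreover have "\<Psi> \<noteq> {}" by (simp add: \<Psi>_def)
  ultimately obtain B w where B: "B \<in> K" and w: "w \<in> valuations B"
    and pos_B: "\<And>u \<gamma>. u \<in> variants B Q w \<Longrightarrow> \<gamma> \<in> \<Gamma> \<Longrightarrow> eval B u \<gamma> = one B"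
    and neg_B: "\<And>\<psi>. \<psi> \<in> \<Psi> \<Longrightarrow> eval B w \<psi> \<noteq> one B"
    using joint_refutation[OF inf e K fin\<Psi>, of Q \<Gamma>] by blast
  have pos_B': "eval B u \<gamma> = one B" if u: "u \<in> variants B Od w" and \<gamma>: "\<gamma> \<in> \<Gamma>" for u \<gamma>
  proof -
    have "(\<lambda>j. if j \<in> Q then u j else w j) \<in> variants B Q w"
      using u w by (auto simp: variants_def valuations_def)
    from pos_B[OF this \<gamma>] show ?thesis
      using u \<gamma> by (subst eval_cong[of \<gamma> u]) (auto simp: variants_def Q_def)
  qed
  define h where "h a = w (2 * pos bs a)" for a
  have hB: "h a \<in> carr B" for a
    using w by (simp add: h_def valuations_def)
  have transfer_pos: "eval B u \<phi> = one B"
    if v: "v \<in> valuations A" and bs_v: "v ` (vars \<phi> - X) \<subseteq> set bs"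
      and n: "to_nat (name_params bs X v \<phi>) < n"
      and all: "\<forall>u\<in>variants A X v. eval A u \<phi> = one A"
      and u: "u \<in> variants B X (\<lambda>j. h (v j))" for \<phi> X v u
  proof -
    have "eval A t (name_params bs X v \<phi>) = one A" if t: "t \<in> variants A Od val" for t
    proof -
      have "(\<lambda>j. if j \<in> X then t (2 * j + 1) else v j) \<in> variants A X v"
        using t v by (auto simp: variants_def valuations_def)
      then have "eval A (\<lambda>j. if j \<in> X then t (2 * j + 1) else v j) \<phi> = one A"
        using all by blast
      moreover have "t (2 * pos bs (v j)) = v j" if "j \<in> vars \<phi>" "j \<notin> X" for j
        using t val_pos[of "v j"] bs_v that by (auto simp: variants_def Od_def)
      ultimately show ?thesis
        unfolding name_params_def eval_subst
        by (subst (asm) eval_cong[of \<phi> _ "\<lambda>i. eval A t (Var (if i \<in> X then 2 * i + 1 else 2 * pos bs (v i)))"]) auto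
    qed
    then have \<Gamma>: "name_params bs X v \<phi> \<in> \<Gamma>"
      using n by (simp add: \<Gamma>_def)
    \<comment> \<open>\<open>t\<close> undoes the naming: the odd variable \<open>2 * j + 1\<close>
      gets the value of \<open>j\<close> under \<open>u\<close>.\<close>
    define t where "t k = (if odd k \<and> k div 2 \<in> X then u (k div 2) else w k)" for k
    have "t \<in> variants B Od w"
      using u w by (auto simp: t_def variants_def valuations_def Od_def)
    from pos_B'[OF this \<Gamma>] have "eval B t (name_params bs X v \<phi>) = one B" .
    moreover have "eval B t (Var (if j \<in> X then 2 * j + 1 else 2 * pos bs (v j))) = u j" for j
      using u by (auto simp: t_def variants_def h_def)
    ultimately show ?thesis
      by (simp add: name_params_def eval_subst)
  qed
  have transfer_neg: "eval B (\<lambda>j. h (v j)) \<phi> \<noteq> one B"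
    if v: "v \<in> valuations A" and bs_v: "v ` (vars \<phi> - {}) \<subseteq> set bs"
      and n: "to_nat (name_params bs {} v \<phi>) < n" and neg: "eval A v \<phi> \<noteq> one A" for \<phi> v
  proof -
    have "eval A val (name_params bs {} v \<phi>) = eval A v \<phi>"
      unfolding name_params_def eval_subst
      by (rule eval_cong) (use bs_v val_pos in auto)
    then have "name_params bs {} v \<phi> \<in> \<Psi>"
      using n neg by (auto simp: \<Psi>_def name_params_def vars_subst Od_def)
    from neg_B[OF this] show ?thesis
      by (simp add: name_params_def eval_subst h_def)
  qed
  show ?thesis
    unfolding diagram_model_def
  proof (intro bexI[OF _ B] exI[of _ h] conjI allI impI ballI)
    fix \<phi> X v u
    assume "v \<in> valuations A" "v ` (vars \<phi> - X) \<subseteq> set bs" "to_nat (name_params bs X v \<phi>) < n"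
      "\<forall>u\<in>variants A X v. eval A u \<phi> = one A" "u \<in> variants B X (\<lambda>j. h (v j))"
    then show "eval B u \<phi> = one B" by (rule transfer_pos)
  next
    fix \<phi> X v
    assume "v \<in> valuations A" "v ` (vars \<phi> - X) \<subseteq> set bs" "to_nat (name_params bs X v \<phi>) < n"
      "X = {}" "eval A v \<phi> \<noteq> one A"
    then show "eval B (\<lambda>j. h (v j)) \<phi> \<noteq> one B" using transfer_neg by simp
  qed (rule hB)
qed

text \<open>An index stands for a finite piece of the diagram, and \<open>cov\<close> collects the
  pieces that mention a given formula with its parameters. Finitely many such sets always meet, so
  some ultrafilter contains them all, and each diagram statement of \<open>A\<close> holds at almost
  all indices.\<close>

theorem inductive_rule_class_axiomatized:
  fixes K :: "'a heyting set" and e :: "'a \<Rightarrow> 'i"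
  assumes inf: "infinite (UNIV :: 'a set)" and e: "inj e"
    and K: "inductive_rule_class TYPE('i) K"
    and HA: "heyting_algebra A" "nondegenerate A" "\<And>R. R \<in> Pi2 K \<Longrightarrow> valid A R"
  shows "A \<in> K"
proof -
  obtain g0 :: "'a list \<times> nat \<Rightarrow> 'a" where "inj g0"
    using infinite_inj_list_nat[OF inf] by blast
  define g where "g = e \<circ> g0"
  have g: "inj g"
    using e \<open>inj g0\<close> by (simp add: g_def inj_compose)
  define I where "I = g ` {(bs, n). set bs \<subseteq> carr A}"
  define bs where "bs i = fst (inv g i)" for i
  define n where "n i = snd (inv g i)" for i
  have bs_g: "bs (g (xs, k)) = xs" "n (g (xs, k)) = k" for xs k
    using g by (simp_all add: bs_def n_def)
  have bsA: "set (bs i) \<subseteq> carr A" if "i \<in> I" for i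
    using that by (auto simp: I_def bs_g)
  define cov where "cov \<phi> X v = {i \<in> I. v ` (vars \<phi> - X) \<subseteq> set (bs i) \<and>
    to_nat (name_params (bs i) X v \<phi>) < n i}" for \<phi> X v
  define CC where "CC = (\<lambda>(\<phi>, X, v). cov \<phi> X v) ` {(\<phi>, X, v). v \<in> valuations A}"
  have "CC \<subseteq> Pow I"
    by (auto simp: CC_def cov_def)
  moreover have "I \<inter> \<Inter>G \<noteq> {}" if G: "finite G" "G \<subseteq> CC" for G
  proof -
    obtain F where F: "F \<subseteq> {(\<phi>, X, v). v \<in> valuations A}" "finite F"
      "G = (\<lambda>(\<phi>, X, v). cov \<phi> X v) ` F"
      using finite_subset_image[OF G(1) G(2)[unfolded CC_def]] by blast
    \<comment> \<open>The parameter list is fixed before the bound \<open>k\<close>, because the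
      naming, and with it the code of a formula, depends on the list.\<close>
    define S where "S = (\<Union>(\<phi>, X, v)\<in>F. v ` (vars \<phi> - X))"
    have "finite S" using F(2) by (auto simp: S_def)
    then obtain xs where xs: "set xs = S" using finite_list by blast
    have SA: "S \<subseteq> carr A"
      using F(1) by (auto simp: S_def valuations_def)
    have "finite ((\<lambda>(\<phi>, X, v). to_nat (name_params xs X v \<phi>)) ` F)"
      using F(2) by simp
    then obtain k where k: "\<forall>m\<in>(\<lambda>(\<phi>, X, v). to_nat (name_params xs X v \<phi>)) ` F. m < k"
      using finite_nat_set_iff_bounded by blast
    have "g (xs, k) \<in> I" using xs SA by (auto simp: I_def)
    moreover have "g (xs, k) \<in> cov \<phi> X v" if "(\<phi>, X, v) \<in> F" for \<phi> X v
      using that k xs \<open>g (xs, k) \<in> I\<close> by (force simp: cov_def bs_g S_def)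
    ultimately show ?thesis
      unfolding F(3) by blast
  qed
  ultimately obtain U where U: "ultrafilter_on I U" and CCU: "CC \<subseteq> U"
    using ultrafilter_extends_fip[of CC I] by blast
  have cov_U: "cov \<phi> X v \<in> U" if "v \<in> valuations A" for \<phi> X v
    using CCU that by (force simp: CC_def)
  have "\<forall>i\<in>I. \<exists>B. B \<in> K \<and> (\<exists>h. diagram_model A (bs i) (n i) B h)"
    using finite_diagram_model[OF inf e K HA bsA] by blast
  then obtain B where B: "\<forall>i\<in>I. B i \<in> K \<and> (\<exists>h. diagram_model A (bs i) (n i) (B i) h)"
    by (rule bchoice[THEN exE])
  then have "\<forall>i\<in>I. \<exists>h. diagram_model A (bs i) (n i) (B i) h"
    by blast
  then obtain h where h: "\<forall>i\<in>I. diagram_model A (bs i) (n i) (B i) (h i)"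
    by (rule bchoice[THEN exE])
  have BK: "B i \<in> K" if "i \<in> I" for i
    using B that by blast
  have hB: "h i a \<in> carr (B i)" if "i \<in> I" for i a
    by (rule diagram_modelD(1)[OF bspec[OF h that]])
  have HB: "heyting_algebra (B i)" if "i \<in> I" for i
    by (rule inductive_rule_class_members(1)[OF K BK[OF that]])
  interpret ultra I U B
    by unfold_locales (use U HB in auto)
  have most_pos: "most (\<lambda>i. \<forall>u\<in>variants (B i) X (\<lambda>j. h i (v j)). eval (B i) u s = eval (B i) u t)"
    if v: "v \<in> valuations A" and st: "\<forall>u\<in>variants A X v. eval A u s = eval A u t" for v X s t
  proof -
    have *: "\<forall>u\<in>variants A X v. eval A u (Iff s t) = one A"
      using st HA(1) by (simp add: eval_Iff_eq_one variants_valuations)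
    have "most (\<lambda>i. i \<in> cov (Iff s t) X v)"
      using cov_U[OF v, of "Iff s t" X] by (simp add: cov_def)
    then show ?thesis
    proof (rule most_mono, intro ballI)
      fix i u assume i: "i \<in> I" "i \<in> cov (Iff s t) X v" and u: "u \<in> variants (B i) X (\<lambda>j. h i (v j))"
      have "eval (B i) u (Iff s t) = one (B i)"
        by (rule diagram_modelD(2)[OF bspec[OF h i(1)] v _ _ * u]) (use i(2) in \<open>simp_all add: cov_def\<close>)
      then show "eval (B i) u s = eval (B i) u t"
        using HB[OF i(1)] u by (simp add: eval_Iff_eq_one variants_valuations)
    qed
  qed
  have hv: "(\<lambda>j. h i (v j)) \<in> valuations (B i)" if "i \<in> I" for i v
    using hB[OF that] by (simp add: valuations_def)
  have most_neg: "most (\<lambda>i. eval (B i) (\<lambda>j. h i (v j)) s \<noteq> eval (B i) (\<lambda>j. h i (v j)) t)"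
    if v: "v \<in> valuations A" and st: "eval A v s \<noteq> eval A v t" for v s t
  proof -
    have *: "eval A v (Iff s t) \<noteq> one A"
      using st HA(1) v by (simp add: eval_Iff_eq_one)
    have "most (\<lambda>i. i \<in> cov (Iff s t) {} v)"
      using cov_U[OF v, of "Iff s t" "{}"] by (simp add: cov_def)
    then show ?thesis
    proof (rule most_mono)
      fix i assume i: "i \<in> I" "i \<in> cov (Iff s t) {} v"
      have "eval (B i) (\<lambda>j. h i (v j)) (Iff s t) \<noteq> one (B i)"
        by (rule diagram_modelD(3)[OF bspec[OF h i(1)] v _ _ *]) (use i(2) in \<open>simp_all add: cov_def\<close>)
      then show "eval (B i) (\<lambda>j. h i (v j)) s \<noteq> eval (B i) (\<lambda>j. h i (v j)) t"
        using HB[OF i(1)] hv[OF i(1)] by (simp add: eval_Iff_eq_one)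
    qed
  qed
  define f where "f a = (\<lambda>i\<in>I. h i a)" for a
  define H where "H a = cls (f a)" for a
  have f: "f a \<in> carr P" for a
    using hB by (auto simp: f_def)
  have HM: "H a \<in> carr M" for a
    unfolding H_def carr_M using f by blast
  have H_eval: "eval M (\<lambda>j. H (v j)) s = eval M (\<lambda>j. H (v j)) t \<longleftrightarrow> eval A v s = eval A v t"
    if v: "v \<in> valuations A" for v s t
  proof -
    have "eval M (\<lambda>j. H (v j)) s = eval M (\<lambda>j. H (v j)) t \<longleftrightarrow>
        most (\<lambda>i. eval (B i) (\<lambda>j. f (v j) i) s = eval (B i) (\<lambda>j. f (v j) i) t)"
      unfolding H_def by (rule eval_M_eq_iff) (rule f)
    also have "{i \<in> I. eval (B i) (\<lambda>j. f (v j) i) s = eval (B i) (\<lambda>j. f (v j) i) t} =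
        {i \<in> I. eval (B i) (\<lambda>j. h i (v j)) s = eval (B i) (\<lambda>j. h i (v j)) t}"
      by (auto simp: f_def)
    also have "\<dots> \<in> U \<longleftrightarrow> eval A v s = eval A v t"
    proof
      assume "most (\<lambda>i. eval (B i) (\<lambda>j. h i (v j)) s = eval (B i) (\<lambda>j. h i (v j)) t)"
      then show "eval A v s = eval A v t"
        using most_neg[OF v, of s t] by (auto simp: most_not)
    next
      assume "eval A v s = eval A v t"
      then have "most (\<lambda>i. \<forall>u\<in>variants (B i) {} (\<lambda>j. h i (v j)). eval (B i) u s = eval (B i) u t)"
        using v by (intro most_pos) (simp_all add: variants_empty)
      then show "most (\<lambda>i. eval (B i) (\<lambda>j. h i (v j)) s = eval (B i) (\<lambda>j. h i (v j)) t)"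
        by (rule most_mono) (simp add: variants_empty hv)
    qed
    finally show ?thesis .
  qed
  \<comment> \<open>Injectivity and the laws for the operations are instances of
    \<open>H_eval\<close>: variables \<open>0\<close> and \<open>1\<close> name the arguments, and
    \<open>Var 2\<close> names the result of an operation.\<close>
  have inj: "a = b" if "a \<in> carr A" "b \<in> carr A" "H a = H b" for a b
    using H_eval[of "(\<lambda>_. b)(0 := a)" "Var 0" "Var 1"] that by (simp add: valuations_def)
  have hom_A: "H (zero A) = zero M" "H (one A) = one M"
    using H_eval[of "\<lambda>_. zero A" "Var 0" Bot] H_eval[of "\<lambda>_. one A" "Var 0" Top] HA(1)
    by (simp_all add: valuations_def)
  have hom_op: "H (meet A a b) = meet M (H a) (H b)" "H (join A a b) = join M (H a) (H b)"
    "H (impl A a b) = impl M (H a) (H b)" if ab: "a \<in> carr A" "b \<in> carr A" for a b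
    using H_eval[of "(\<lambda>_. meet A a b)(0 := a, 1 := b)" "Var 2" "And (Var 0) (Var 1)"]
      H_eval[of "(\<lambda>_. join A a b)(0 := a, 1 := b)" "Var 2" "Or (Var 0) (Var 1)"]
      H_eval[of "(\<lambda>_. impl A a b)(0 := a, 1 := b)" "Var 2" "Imp (Var 0) (Var 1)"]
      HA(1) ab by (simp_all add: valuations_def)
  define C where "C = M\<lparr>carr := H ` carr A\<rparr>"
  have C_simps: "carr C = H ` carr A" "meet C = meet M" "join C = join M" "impl C = impl M"
    "zero C = zero M" "one C = one M"
    by (simp_all add: C_def)
  have hom: "heyting_hom H A C"
    by (auto simp: heyting_hom_def C_simps hom_A hom_op)
  have sub_hom: "heyting_hom (\<lambda>x. x) C M"
    using HM by (auto simp: heyting_hom_def C_simps)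
  have C: "heyting_algebra C"
  proof (rule heyting_algebra_of_homs[of UNIV "\<lambda>_::unit. M" "\<lambda>_ x. x"])
    show "zero C \<in> carr C" "one C \<in> carr C"
      unfolding C_simps using HA(1) by (simp_all flip: hom_A)
    fix x y assume "x \<in> carr C" "y \<in> carr C"
    then obtain a b where ab: "a \<in> carr A" "b \<in> carr A" "x = H a" "y = H b"
      by (auto simp: C_simps)
    then show "meet C x y \<in> carr C" "join C x y \<in> carr C" "impl C x y \<in> carr C"
      unfolding C_simps using HA(1) by (simp_all flip: hom_op)
  qed (use ultraproduct_heyting sub_hom in auto)
  have "isomorphic A C"
    unfolding isomorphic_iff bij_betw_def
    using hom inj by (intro exI[of _ H]) (auto simp: inj_on_def C_simps)
  moreover have "forall_subalgebra C M"
    unfolding forall_subalgebra_def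
  proof (intro conjI allI ballI impI)
    show "subalgebra C M"
      using C ultraproduct_heyting HM by (auto simp: subalgebra_def C_simps)
    fix s t X v assume v: "v \<in> valuations C" and "finite X" and sat: "sat_all_eq C X v s t"
    have "\<forall>j. \<exists>a. a \<in> carr A \<and> v j = H a"
      using v by (auto simp: valuations_def C_simps)
    then obtain v0 where v0: "\<And>j. v0 j \<in> carr A" "\<And>j. v j = H (v0 j)"
      by metis
    have v0A: "v0 \<in> valuations A" using v0 by (simp add: valuations_def)
    \<comment> \<open>Injectivity of \<open>H\<close> pulls the quantified equation back to
      \<open>A\<close>, from where \<open>most_pos\<close> hands it to almost all
      \<open>B i\<close>.\<close>
    have "eval A u s = eval A u t" if u: "u \<in> variants A X v0" for u
    proof -
      have uA: "u \<in> valuations A" using u by (rule variants_valuations)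
      have "(\<lambda>j. H (u j)) \<in> variants C X v"
        using u by (auto simp: variants_def valuations_def C_simps v0)
      then have "eval C (\<lambda>j. H (u j)) s = eval C (\<lambda>j. H (u j)) t"
        using sat by (simp add: sat_all_eq_def)
      then have "H (eval A u s) = H (eval A u t)"
        using eval_hom[OF HA(1) hom uA] by simp
      then show ?thesis using inj HA(1) uA by simp
    qed
    then have all: "most (\<lambda>i. \<forall>u\<in>variants (B i) X (\<lambda>j. h i (v0 j)). eval (B i) u s = eval (B i) u t)"
      by (intro most_pos[OF v0A]) blast
    show "sat_all_eq M X v s t"
      unfolding sat_all_eq_def
    proof
      fix w assume w: "w \<in> variants M X v"
      then obtain w0 where w0: "\<And>j. w0 j \<in> carr P" "w = (\<lambda>j. cls (w0 j))"
        using valuation_M[OF variants_valuations[OF w]] by metis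
      \<comment> \<open>Outside \<open>X\<close> the representative \<open>w0 j\<close> is only
        equivalent to \<open>f (v0 j)\<close> and may differ from it at some indices. Exchanging the
        two gives a genuine variant in every coordinate.\<close>
      define r where "r j = (if j \<in> X then w0 j else f (v0 j))" for j
      have r: "r j \<in> carr P" for j
        using w0(1) f by (simp add: r_def del: direct_product_simps)
      have wr: "w = (\<lambda>j. cls (r j))"
      proof
        fix j
        show "w j = cls (r j)"
        proof (cases "j \<in> X")
          case True
          then show ?thesis using w0(2) by (simp add: r_def)
        next
          case False
          then have "w j = v j" using w by (simp add: variants_def)
          then show ?thesis using False by (simp add: r_def v0(2) H_def)
        qed
      qed
      have "most (\<lambda>i. eval (B i) (\<lambda>j. r j i) s = eval (B i) (\<lambda>j. r j i) t)"
      proof (rule most_mono[OF all])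
        fix i assume i: "i \<in> I"
          and *: "\<forall>u\<in>variants (B i) X (\<lambda>j. h i (v0 j)). eval (B i) u s = eval (B i) u t"
        have "(\<lambda>j. r j i) \<in> variants (B i) X (\<lambda>j. h i (v0 j))"
          using valuation_A[of r, OF r i] i by (auto simp: variants_def r_def f_def)
        then show "eval (B i) (\<lambda>j. r j i) s = eval (B i) (\<lambda>j. r j i) t"
          using * by blast
      qed
      then show "eval M w s = eval M w t"
        unfolding wr using eval_M_eq_iff[of r s t] r by blast
    qed
  qed
  ultimately have "copy_of_forall_subalgebra A M"
    using HA(1) by (auto simp: copy_of_forall_subalgebra_def)
  then show ?thesis
    using inductive_rule_class_ultraproduct[where A = B, OF K U BK] by blast
qed

section \<open>The free algebra of a rule system\<close>

text \<open>The model is the Lindenbaum algebra of the formulas derivable in \<^term>\<open>S\<close>. A rule is valid in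
  it because its bound variables can be instantiated with fresh variables, and then rule cut
  applies.\<close>

lemma pi2_rule_system_has_model:
  fixes K :: "'a heyting set"
  assumes inf: "infinite (UNIV :: 'a set)"
    and S: "pi2_rule_system S" and K: "Pi2 K \<subseteq> S" "\<And>A. A \<in> K \<Longrightarrow> heyting_algebra A"
    and con: "({}, {}, Bot) \<notin> S"
  shows "\<exists>F :: 'a heyting. heyting_algebra F \<and> nondegenerate F \<and> (\<forall>R\<in>S. valid F R)"
proof -
  define T where "T = {\<chi>. ({}, {}, \<chi>) \<in> S}"
  \<comment> \<open>With an empty premise set the side condition of rule cut is vacuous, so theorems
    are closed under all rules of \<open>S\<close>, bound variables included.\<close>
  have cut: "\<psi> \<in> T" if "(\<Delta>, Q, \<psi>) \<in> S" "\<Delta> \<subseteq> T" for \<Delta> Q \<psi>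
  proof -
    have "rule_cut S" using S by (simp add: pi2_rule_system_def)
    note rule_cut = this[unfolded rule_cut_def, THEN spec[of _ "{}"], THEN spec[of _ "{}"],
        THEN spec[of _ \<Delta>], THEN spec[of _ Q], THEN spec[of _ \<psi>]]
    have "\<forall>\<delta>\<in>\<Delta>. ({}, {}, \<delta>) \<in> S" using that(2) by (auto simp: T_def)
    then show ?thesis using rule_cut that(1) by (simp add: T_def pi2_rules_def)
  qed
  \<comment> \<open>A consequence that holds at every valuation in \<open>K\<close> is a rule of
    \<open>Pi2 K\<close>, hence of \<open>S\<close>. This replaces syntactic derivations by
    computations in Heyting algebras.\<close>
  have conseq: "\<psi> \<in> T" if fin: "finite \<Delta>" "\<Delta> \<subseteq> T"
    and sem: "\<And>A v. A \<in> K \<Longrightarrow> heyting_algebra A \<Longrightarrow> v \<in> valuations A \<Longrightarrow>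
      \<forall>\<delta>\<in>\<Delta>. eval A v \<delta> = one A \<Longrightarrow> eval A v \<psi> = one A" for \<Delta> \<psi>
  proof -
    have "valid A (\<Delta>, {}, \<psi>)" if "A \<in> K" for A
      using sem[OF that K(2)[OF that]] by (intro validI) (simp add: variants_empty)
    then have "(\<Delta>, {}, \<psi>) \<in> Pi2 K"
      using fin(1) by (simp add: Pi2_def pi2_rules_def)
    then show ?thesis
      using cut K(1) fin(2) by blast
  qed
  define eqv where "eqv \<phi> \<psi> \<longleftrightarrow> Iff \<phi> \<psi> \<in> T" for \<phi> \<psi>
  have eqvI: "eqv \<phi> \<psi>" if "\<And>A v. A \<in> K \<Longrightarrow> heyting_algebra A \<Longrightarrow> v \<in> valuations A \<Longrightarrow>
      eval A v \<phi> = eval A v \<psi>" for \<phi> \<psi>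
    unfolding eqv_def by (rule conseq[of "{}"]) (use that in \<open>simp_all add: eval_Iff_eq_one\<close>)
  have eqv2: "eqv \<phi> \<psi>" if 1: "eqv \<phi>1 \<psi>1" and 2: "eqv \<phi>2 \<psi>2"
    and sem: "\<And>A v. A \<in> K \<Longrightarrow> heyting_algebra A \<Longrightarrow> v \<in> valuations A \<Longrightarrow> eval A v \<phi>1 = eval A v \<psi>1 \<Longrightarrow>
      eval A v \<phi>2 = eval A v \<psi>2 \<Longrightarrow> eval A v \<phi> = eval A v \<psi>" for \<phi> \<psi> \<phi>1 \<psi>1 \<phi>2 \<psi>2
    unfolding eqv_def
    by (rule conseq[of "{Iff \<phi>1 \<psi>1, Iff \<phi>2 \<psi>2}"])
      (use 1 2 sem in \<open>auto simp: eqv_def eval_Iff_eq_one\<close>)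
  have refl: "eqv \<phi> \<phi>" for \<phi>
    by (rule eqvI) simp
  have sym: "eqv \<psi> \<phi>" if "eqv \<phi> \<psi>" for \<phi> \<psi>
    by (rule eqv2[OF that that]) simp
  have trans: "eqv \<phi> \<chi>" if "eqv \<phi> \<psi>" "eqv \<psi> \<chi>" for \<phi> \<psi> \<chi>
    by (rule eqv2[OF that]) simp
  obtain c0 :: "nat \<Rightarrow> 'a" where c0: "inj c0"
    using infinite_countable_subset[OF inf] by blast
  \<comment> \<open>The class of a formula is represented by the code of a chosen member. Equivalent
    formulas define the same predicate, so \<open>SOME\<close> chooses the same member for
    them.\<close>
  define c where "c \<phi> = c0 (to_nat (SOME \<psi>. eqv \<phi> \<psi>))" for \<phi> :: fm
  have c_iff: "c \<phi> = c \<psi> \<longleftrightarrow> eqv \<phi> \<psi>" for \<phi> \<psi>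
  proof
    assume "c \<phi> = c \<psi>"
    then have "(SOME \<chi>. eqv \<phi> \<chi>) = (SOME \<chi>. eqv \<psi> \<chi>)"
      using c0 by (simp add: c_def inj_eq)
    moreover have "eqv \<phi> (SOME \<chi>. eqv \<phi> \<chi>)" "eqv \<psi> (SOME \<chi>. eqv \<psi> \<chi>)"
      using refl by (auto intro: someI)
    ultimately show "eqv \<phi> \<psi>" using sym trans by metis
  next
    assume "eqv \<phi> \<psi>"
    then have "eqv \<phi> = eqv \<psi>" using sym trans by blast
    then show "c \<phi> = c \<psi>" by (simp add: c_def)
  qed
  define d where "d x = (SOME \<phi>. c \<phi> = x)" for x
  have "c (d (c \<phi>)) = c \<phi>" for \<phi>
    unfolding d_def by (rule someI) (rule HOL.refl)
  then have d: "eqv (d (c \<phi>)) \<phi>" for \<phi>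
    using c_iff by blast
  define F where "F = \<lparr>carr = range c,
      meet = \<lambda>x y. c (And (d x) (d y)), join = \<lambda>x y. c (Or (d x) (d y)),
      impl = \<lambda>x y. c (Imp (d x) (d y)), zero = c Bot, one = c Top\<rparr>"
  have F: "carr F = range c" "meet F (c \<phi>) (c \<psi>) = c (And \<phi> \<psi>)" "join F (c \<phi>) (c \<psi>) = c (Or \<phi> \<psi>)"
    "impl F (c \<phi>) (c \<psi>) = c (Imp \<phi> \<psi>)" "zero F = c Bot" "one F = c Top" for \<phi> \<psi>
    unfolding F_def by (auto simp: c_iff intro: eqv2[OF d[of \<phi>] d[of \<psi>]])
  have one_iff: "c \<phi> = one F \<longleftrightarrow> \<phi> \<in> T" for \<phi>
  proof -
    have "Iff \<phi> Top \<in> T \<longleftrightarrow> \<phi> \<in> T"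
    proof
      assume "Iff \<phi> Top \<in> T"
      then show "\<phi> \<in> T"
        by (intro conseq[of "{Iff \<phi> Top}"]) (simp_all add: eval_Iff_eq_one)
    next
      assume "\<phi> \<in> T"
      then show "Iff \<phi> Top \<in> T"
        by (intro conseq[of "{\<phi>}"]) (simp_all add: eval_Iff_eq_one)
    qed
    then show ?thesis by (simp add: F c_iff eqv_def)
  qed
  have HF: "heyting_algebra F"
    unfolding heyting_algebra_def le_def F(1) ball_simps F
  proof (intro conjI allI)
    fix \<phi> \<psi> \<chi>
    show "c (And (And \<phi> \<psi>) \<chi>) = c (And \<phi> (And \<psi> \<chi>))" "c (Or (Or \<phi> \<psi>) \<chi>) = c (Or \<phi> (Or \<psi> \<chi>))"
      unfolding c_iff by (rule eqvI; simp add: heyting_assoc)+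
    show "c (And \<phi> \<psi>) = c (And \<psi> \<phi>)" "c (Or \<phi> \<psi>) = c (Or \<psi> \<phi>)"
      unfolding c_iff by (rule eqvI; simp add: heyting_comm[OF _ eval_in_carr eval_in_carr])+
    show "c (And \<phi> (Or \<phi> \<psi>)) = c \<phi>" "c (Or \<phi> (And \<phi> \<psi>)) = c \<phi>"
      unfolding c_iff by (rule eqvI; simp add: heyting_absorb)+
    show "c (And Bot \<phi>) = c Bot" "c (And \<phi> Top) = c \<phi>"
      unfolding c_iff by (rule eqvI; simp add: heyting_bounds)+
    show "c (And (And \<phi> \<psi>) \<chi>) = c (And \<phi> \<psi>) \<longleftrightarrow> c (And \<phi> (Imp \<psi> \<chi>)) = c \<phi>"
      unfolding c_iff
    proof
      assume "eqv (And (And \<phi> \<psi>) \<chi>) (And \<phi> \<psi>)"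
      from eqv2[OF this this] show "eqv (And \<phi> (Imp \<psi> \<chi>)) \<phi>"
        by (simp add: heyting_residuation)
    next
      assume "eqv (And \<phi> (Imp \<psi> \<chi>)) \<phi>"
      from eqv2[OF this this] show "eqv (And (And \<phi> \<psi>) \<chi>) (And \<phi> \<psi>)"
        by (simp add: heyting_residuation)
    qed
  qed auto
  have nondeg: "nondegenerate F"
    using con one_iff[of Bot] by (simp add: nondegenerate_def F T_def)
  have eval_F: "eval F (\<lambda>i. c (\<sigma> i)) \<phi> = c (subst \<sigma> \<phi>)" for \<sigma> \<phi>
    by (induction \<phi>) (simp_all add: F)
  have "valid F (\<Gamma>, Q, \<psi>)" if R: "(\<Gamma>, Q, \<psi>) \<in> S" for \<Gamma> Q \<psi>
  proof (rule validI)
    fix v assume v: "v \<in> valuations F"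
      and prem: "\<And>w \<gamma>. w \<in> variants F Q v \<Longrightarrow> \<gamma> \<in> \<Gamma> \<Longrightarrow> eval F w \<gamma> = one F"
    have "\<forall>i. \<exists>\<phi>. v i = c \<phi>"
      using v by (auto simp: valuations_def F)
    then obtain \<sigma> where \<sigma>: "v = (\<lambda>i. c (\<sigma> i))" by metis
    have finR: "finite \<Gamma>" "finite Q" "vars \<psi> \<inter> Q = {}"
      using R S by (auto simp: pi2_rule_system_def pi2_rules_def)
    define W where "W = ((\<Union>\<gamma>\<in>\<Gamma>. vars \<gamma>) - Q) \<union> vars \<psi>"
    define V where "V = W \<union> (\<Union>i\<in>W. vars (\<sigma> i))"
    have "finite W" using finR by (simp add: W_def)
    then have "finite V" by (simp add: V_def)
    then obtain m where m: "\<forall>k\<in>V. k < m" using finite_nat_set_iff_bounded by blast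
    \<comment> \<open>Shifting by \<open>m\<close> makes the bound variables fresh for the rule and
      for the formulas put in place of its free variables.\<close>
    define f where "f i = m + i" for i
    have fV: "f ` Q \<inter> V = {}" using m by (auto simp: f_def)
    define \<Gamma>' where "\<Gamma>' = subst (\<lambda>i. Var (if i \<in> Q then f i else i)) ` \<Gamma>"
    have "alpha_renaming S" using S by (simp add: pi2_rule_system_def)
    moreover have "inj_on f Q" by (simp add: f_def inj_on_def)
    moreover have "f ` Q \<inter> ((\<Union>\<gamma>\<in>\<Gamma>. vars \<gamma>) - Q) = {}" "f ` Q \<inter> vars \<psi> = {}"
      using fV by (auto simp: V_def W_def)
    ultimately have R': "(\<Gamma>', f ` Q, \<psi>) \<in> S"
      using R unfolding alpha_renaming_def \<Gamma>'_def by blast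
    \<comment> \<open>Bound structurality constrains the substitution at all free variables, also
      those outside the rule. There \<open>\<sigma>\<close> might capture, so \<open>Top\<close> is
      used instead.\<close>
    define \<tau> where "\<tau> i = (if i \<in> f ` Q then Var i else if i \<in> W then \<sigma> i else Top)" for i
    have "\<forall>i. i \<notin> f ` Q \<longrightarrow> vars (\<tau> i) \<inter> f ` Q = {}"
      using fV by (auto simp: \<tau>_def V_def)
    moreover have "\<forall>i\<in>f ` Q. \<tau> i = Var i" by (simp add: \<tau>_def)
    moreover have "bound_structurality S" using S by (simp add: pi2_rule_system_def)
    note this[unfolded bound_structurality_def, THEN spec[of _ \<Gamma>'], THEN spec[of _ "f ` Q"],
        THEN spec[of _ \<psi>], THEN spec[of _ \<tau>]]
    ultimately have R'': "(subst \<tau> ` \<Gamma>', f ` Q, subst \<tau> \<psi>) \<in> S"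
      using R' by blast
    have "subst \<tau> \<delta> \<in> T" if \<delta>: "\<delta> \<in> \<Gamma>'" for \<delta>
    proof -
      obtain \<gamma> where \<gamma>: "\<gamma> \<in> \<Gamma>" "\<delta> = subst (\<lambda>i. Var (if i \<in> Q then f i else i)) \<gamma>"
        using \<delta> unfolding \<Gamma>'_def by blast
      \<comment> \<open>The fresh variables act as generic values of the bound ones: their classes
        give one particular variant of \<open>v\<close>, and the premise at this variant says that
        the renamed instance is a theorem.\<close>
      define \<rho> where "\<rho> i = (if i \<in> Q then Var (f i) else \<sigma> i)" for i
      have "subst \<tau> \<delta> = subst \<rho> \<gamma>"
        unfolding \<gamma>(2) subst_subst
      proof (rule subst_cong)
        fix i assume "i \<in> vars \<gamma>"
        then show "subst \<tau> (Var (if i \<in> Q then f i else i)) = \<rho> i"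
          using fV \<gamma>(1) by (auto simp: \<tau>_def \<rho>_def V_def W_def)
      qed
      moreover have "(\<lambda>i. c (\<rho> i)) \<in> variants F Q v"
        by (auto simp: variants_def valuations_def F \<rho>_def \<sigma>)
      then have "c (subst \<rho> \<gamma>) = one F"
        using prem[OF _ \<gamma>(1)] unfolding eval_F[symmetric] by blast
      ultimately show ?thesis
        by (simp add: one_iff)
    qed
    then have "subst \<tau> \<psi> \<in> T"
      using cut[OF R''] by blast
    moreover have "subst \<tau> \<psi> = subst \<sigma> \<psi>"
      by (rule subst_cong) (use fV in \<open>auto simp: \<tau>_def V_def W_def\<close>)
    ultimately show "eval F v \<psi> = one F"
      unfolding \<sigma> eval_F one_iff by simp
  qed
  then have "\<forall>R\<in>S. valid F R" by auto
  with HF nondeg show ?thesis by blast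
qed

section \<open>Inductive completeness\<close>

text \<open>Validity of \<open>R\<close> is shown for the product or ultraproduct itself, which need
  not lie on \<open>'a\<close>, and then descends to the copies of its
  \<forall>-subalgebras.\<close>

lemma inductive_rule_class_restrict:
  fixes K :: "'a heyting set"
  assumes K: "inductive_rule_class TYPE('i) K" and R: "R \<in> pi2_rules"
  shows "inductive_rule_class TYPE('i) {A \<in> K. valid A R}"
proof -
  obtain \<Gamma> Q \<psi> where R_eq: "R = (\<Gamma>, Q, \<psi>)" by (cases R) auto
  have fin: "finite \<Gamma>" using R by (simp add: R_eq pi2_rules_def)
  note copy = valid_copy_of_forall_subalgebra[OF _ _ R]
  note H = inductive_rule_class_members(1)[OF K]
  show ?thesis
    unfolding inductive_rule_class_def
  proof (intro conjI ballI allI impI)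
    fix A assume "A \<in> {A \<in> K. valid A R}"
    then show "godel_algebra A" "nondegenerate A"
      using inductive_rule_class_members[OF K] by auto
  next
    fix A B :: "'a heyting" assume "A \<in> {A \<in> K. valid A R}" "copy_of_forall_subalgebra B A"
    then show "B \<in> {A \<in> K. valid A R}"
      using inductive_rule_class_copy[OF K] copy by auto
  next
    fix I :: "'i set" and A and B :: "'a heyting"
    assume I: "I \<noteq> {}" and A: "\<forall>i\<in>I. A i \<in> {A \<in> K. valid A R}"
      and B: "copy_of_forall_subalgebra B (direct_product I A)"
    have "valid (direct_product I A) R"
      unfolding R_eq using A H by (intro valid_direct_product) (auto simp: R_eq)
    then have "valid B R" by (rule copy[OF B])
    moreover have "B \<in> K"
      using inductive_rule_class_product[OF K I _ B] A by auto
    ultimately show "B \<in> {A \<in> K. valid A R}" by simp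
  next
    fix I :: "'i set" and U A and B :: "'a heyting"
    assume U: "ultrafilter_on I U" and AK: "\<forall>i\<in>I. A i \<in> {A \<in> K. valid A R}"
      and B: "copy_of_forall_subalgebra B (ultraproduct I U A)"
    interpret ultra I U A
      by unfold_locales (use U AK H in auto)
    have "valid (ultraproduct I U A) R"
      unfolding R_eq using AK fin by (intro valid_ultraproduct) (auto simp: R_eq)
    then have "valid B R" by (rule copy[OF B])
    moreover have "B \<in> K"
      using inductive_rule_class_ultraproduct[OF K U _ B] AK by auto
    ultimately show "B \<in> {A \<in> K. valid A R}" by simp
  qed
qed

lemma minimal_imp_inductively_complete:
  fixes K :: "'a heyting set" and e :: "'a \<Rightarrow> 'i"
  assumes inf: "infinite (UNIV :: 'a set)" and e: "inj e"
    and K: "inductive_rule_class TYPE('i) K" "K \<noteq> {}"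
    and min: "\<And>K'. inductive_rule_class TYPE('i) K' \<Longrightarrow> K' \<noteq> {} \<Longrightarrow> K' \<subseteq> K \<Longrightarrow> K' = K"
  shows "inductively_complete K"
  unfolding inductively_complete_def
proof (intro ballI impI)
  fix R assume R: "R \<in> pi2_rules" and adm: "admissible K R"
  note H = inductive_rule_class_members[OF K(1)]
  have "({}, {}, Bot) \<notin> Pi2 K"
  proof
    assume "({}, {}, Bot) \<in> Pi2 K"
    moreover obtain A where A: "A \<in> K" using K(2) by blast
    ultimately have "valid A ({}, {}, Bot)" by (simp add: Pi2_def)
    moreover have "(\<lambda>_. zero A) \<in> valuations A"
      using H(1)[OF A] by (simp add: valuations_def)
    ultimately show False
      using H(3)[OF A] by (auto simp: valid_axiom_iff nondegenerate_def)
  qed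
  then have con: "({}, {}, Bot) \<notin> oplus (Pi2 K) R"
    using adm by (auto simp: admissible_def)
  have "pi2_rule_system (oplus (Pi2 K) R)"
    by (rule pi2_rule_system_oplus) (use R in \<open>auto simp: Pi2_def\<close>)
  moreover have sup: "Pi2 K \<subseteq> oplus (Pi2 K) R" "R \<in> oplus (Pi2 K) R"
    using oplus_superset[of "Pi2 K" R] by auto
  ultimately obtain F :: "'a heyting" where F: "heyting_algebra F" "nondegenerate F"
    "\<forall>R\<in>oplus (Pi2 K) R. valid F R"
    using pi2_rule_system_has_model[OF inf _ _ H(1) con] by blast
  have "F \<in> K"
    by (rule inductive_rule_class_axiomatized[OF inf e K(1) F(1,2)]) (use F(3) sup in blast)
  then have "{A \<in> K. valid A R} \<noteq> {}" using F(3) sup(2) by blast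
  then have "{A \<in> K. valid A R} = K"
    by (intro min inductive_rule_class_restrict[OF K(1) R]) auto
  then show "R \<in> Pi2 K" using R by (auto simp: Pi2_def)
qed

text \<open>If some member of \<^term>\<open>K\<close> refutes \<^term>\<open>\<chi>\<close>, then every member is a factor of a member
  refuting \<^term>\<open>\<chi>\<close>, so the rule saying that \<^term>\<open>\<chi>\<close> fails is admissible. Hence all members of
  an inductively complete class have the same equational theory.\<close>

lemma inductively_complete_same_theory:
  fixes K :: "'a heyting set" and e :: "'a \<Rightarrow> 'i"
  assumes inf: "infinite (UNIV :: 'a set)" and e: "inj e"
    and K: "inductive_rule_class TYPE('i) K" and comp: "inductively_complete K"
    and A: "A \<in> K" "valid A ({}, {}, \<chi>)" and B: "B \<in> K"
  shows "valid B ({}, {}, \<chi>)"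
proof (rule ccontr)
  note H = inductive_rule_class_members[OF K]
  assume "\<not> valid B ({}, {}, \<chi>)"
  then obtain b where b: "b \<in> valuations B" "eval B b \<chi> \<noteq> one B"
    by (auto simp: valid_axiom_iff)
  \<comment> \<open>Binding all variables of \<open>\<chi>\<close> makes the premise its universal
    closure, which the conclusion \<open>Bot\<close> denies in nondegenerate algebras.\<close>
  define R where "R = ({\<chi>}, vars \<chi>, Bot)"
  have R: "R \<in> pi2_rules" by (simp add: R_def pi2_rules_def)
  have "admissible K R"
    unfolding admissible_def
  proof (intro allI impI)
    fix \<theta> assume \<theta>: "({}, {}, \<theta>) \<in> oplus (Pi2 K) R"
    \<comment> \<open>By soundness \<open>\<theta>\<close> holds throughout \<open>K'\<close>; from
      a product in \<open>K'\<close> it passes to the factor \<open>C\<close> along the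
      projection.\<close>
    define K' where "K' = {A \<in> K. valid A R}"
    have "pi2_rule_system (Pi2 K')"
      by (rule pi2_rule_system_Pi2) (use H(1) in \<open>auto simp: K'_def\<close>)
    moreover have "Pi2 K \<union> {R} \<subseteq> Pi2 K'"
      using R by (auto simp: K'_def Pi2_def)
    ultimately have "oplus (Pi2 K) R \<subseteq> Pi2 K'"
      by (rule oplus_least)
    with \<theta> have \<theta>K': "valid D ({}, {}, \<theta>)" if "D \<in> K'" for D
      using that by (auto simp: Pi2_def)
    have "valid C ({}, {}, \<theta>)" if C: "C \<in> K" for C
      unfolding valid_axiom_iff
    proof
      fix v assume v: "v \<in> valuations C"
      obtain D p q where D: "D \<in> K" and hom: "heyting_hom p D B" "heyting_hom q D C"
        and surj: "\<And>b c. b \<in> carr B \<Longrightarrow> c \<in> carr C \<Longrightarrow> \<exists>d\<in>carr D. p d = b \<and> q d = c"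
        using binary_product_in_class[OF inf e K B C] by blast
      have "\<exists>d\<in>carr D. p d = b j \<and> q d = v j" for j
        using surj b(1) v by (simp add: valuations_def)
      then obtain u where u: "\<And>j. u j \<in> carr D" "\<And>j. p (u j) = b j" "\<And>j. q (u j) = v j"
        by metis
      then have uD: "u \<in> valuations D" by (simp add: valuations_def)
      have one: "p (one D) = one B" "q (one D) = one C"
        using hom by (auto simp: heyting_hom_def)
      have neg: "eval D u \<chi> \<noteq> one D"
        using eval_hom[OF H(1)[OF D] hom(1) uD, of \<chi>] b(2) one u by auto
      have "valid D R"
        unfolding R_def
      proof (rule validI)
        fix t assume t: "t \<in> valuations D"
          and prem: "\<And>w \<gamma>. w \<in> variants D (vars \<chi>) t \<Longrightarrow> \<gamma> \<in> {\<chi>} \<Longrightarrow> eval D w \<gamma> = one D"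
        have "(\<lambda>i. if i \<in> vars \<chi> then u i else t i) \<in> variants D (vars \<chi>) t"
          using uD t by (auto simp: variants_def valuations_def)
        then have "eval D (\<lambda>i. if i \<in> vars \<chi> then u i else t i) \<chi> = one D"
          using prem by blast
        moreover have "eval D (\<lambda>i. if i \<in> vars \<chi> then u i else t i) \<chi> = eval D u \<chi>"
          by (rule eval_cong) simp
        ultimately show "eval D t Bot = one D" using neg by simp
      qed
      then have "valid D ({}, {}, \<theta>)" using \<theta>K' D by (simp add: K'_def)
      then have "eval D u \<theta> = one D" using uD by (simp add: valid_axiom_iff)
      then show "eval C v \<theta> = one C"
        using eval_hom[OF H(1)[OF D] hom(2) uD, of \<theta>] one u by simp
    qed
    then show "({}, {}, \<theta>) \<in> Pi2 K"
      by (simp add: Pi2_def pi2_rules_def)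
  qed
  then have "valid A R"
    using comp R A(1) by (auto simp: inductively_complete_def Pi2_def)
  moreover have "(\<lambda>_. zero A) \<in> valuations A"
    using H(1)[OF A(1)] by (simp add: valuations_def)
  ultimately have "eval A (\<lambda>_. zero A) Bot = one A"
    unfolding R_def
    by (rule validD) (use A(2) in \<open>auto simp: valid_axiom_iff dest: variants_valuations\<close>)
  then show False using H(3)[OF A(1)] by (simp add: nondegenerate_def)
qed

text \<open>Since \<open>K'\<close> is axiomatized by its rules, it suffices to compare rules.
  Admissibility tests only theorems, and those derivable from \<open>Pi2 K\<close> with a rule of
  \<open>K'\<close> are sound for \<open>K'\<close>; by the common equational theory, one member of
  \<open>K'\<close> then speaks for all of \<open>K\<close>.\<close>

lemma inductively_complete_imp_minimal:
  fixes K :: "'a heyting set" and e :: "'a \<Rightarrow> 'i"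
  assumes inf: "infinite (UNIV :: 'a set)" and e: "inj e"
    and K: "inductive_rule_class TYPE('i) K" and comp: "inductively_complete K"
    and K': "inductive_rule_class TYPE('i) K'" "K' \<noteq> {}" "K' \<subseteq> K"
  shows "K' = K"
proof
  obtain A where A: "A \<in> K'" using K'(2) by blast
  have "Pi2 K' \<subseteq> Pi2 K"
  proof
    fix R assume R: "R \<in> Pi2 K'"
    have "pi2_rule_system (Pi2 K')"
      by (rule pi2_rule_system_Pi2) (rule inductive_rule_class_members(1)[OF K'(1)])
    moreover have "Pi2 K \<union> {R} \<subseteq> Pi2 K'"
      using R K'(3) by (auto simp: Pi2_def)
    ultimately have sub: "oplus (Pi2 K) R \<subseteq> Pi2 K'"
      by (rule oplus_least)
    have "admissible K R"
      unfolding admissible_def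
    proof (intro allI impI)
      fix \<chi> assume "({}, {}, \<chi>) \<in> oplus (Pi2 K) R"
      then have "valid A ({}, {}, \<chi>)" using sub A by (auto simp: Pi2_def)
      then have "valid B ({}, {}, \<chi>)" if "B \<in> K" for B
        using inductively_complete_same_theory[OF inf e K comp _ _ that] A K'(3) by blast
      then show "({}, {}, \<chi>) \<in> Pi2 K" by (simp add: Pi2_def pi2_rules_def)
    qed
    then show "R \<in> Pi2 K"
      using comp R by (auto simp: inductively_complete_def Pi2_def)
  qed
  show "K \<subseteq> K'"
  proof
    fix B assume B: "B \<in> K"
    note HB = inductive_rule_class_members[OF K B]
    show "B \<in> K'"
      by (rule inductive_rule_class_axiomatized[OF inf e K'(1) HB(1,3)])
        (use B \<open>Pi2 K' \<subseteq> Pi2 K\<close> in \<open>auto simp: Pi2_def\<close>)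
  qed
qed (rule K'(3))

theorem theorem7p3:
  fixes K :: "'a heyting set" and e :: "'a \<Rightarrow> 'i"
  assumes "infinite (UNIV :: 'a set)" and "inj e"
    and "inductive_rule_class TYPE('i) K" and "K \<noteq> {}"
  shows "inductively_complete K \<longleftrightarrow>
    (\<forall>K'. inductive_rule_class TYPE('i) K' \<and> K' \<noteq> {} \<and> K' \<subseteq> K \<longrightarrow> K' = K)"
  using inductively_complete_imp_minimal[OF assms(1-3)] minimal_imp_inductively_complete[OF assms]
  by blast

end
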